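(* Let $G=A*B$ be a free product of groups $A$ and $B$, and let $g=a_1b_1a_2b_2\cdots a_Lb_L$ with $L\ge1$, $a_i\in A\setminus\{1\}$, $b_i\in B\setminus\{1\}$, and suppose $g\in[G,G]$. Let $N\in\{2,3,\dots\}\cup\{\infty\}$ be the minimum of the orders of the elements $a_1,\dots,a_L,b_1,\dots,b_L$ (with $N=\infty$ if all have infinite order, and the convention $1/\infty=0$). Then $$\mathrm{scl}_G(g)\ \ge\ \frac12-\frac1N.$$
   Context: For a group $G$, $[G,G]$ is its commutator subgroup. For $h\in[G,G]$, the commutator length $\mathrm{cl}_G(h)$ is the least $n\ge 0$ such that $h=[a_1,b_1]\cdots[a_n,b_n]$ for some $a_i,b_i\in G$. The stable commutator length is $\mathrm{scl}_G(g)=\lim_{n\to\infty}\mathrm{cl}_G(g^n)/n$ for $g\in[G,G]$. *)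

theory Defs
  imports "HOL-Analysis.Analysis" "HOL-Algebra.Algebra"
begin

definition fp_reduced :: "('a, 'c) monoid_scheme \<Rightarrow> ('b, 'd) monoid_scheme \<Rightarrow> ('a + 'b) list \<Rightarrow> bool" where
  "fp_reduced A B w \<longleftrightarrow>
     (\<forall>x \<in> set w. case x of Inl a \<Rightarrow> a \<in> carrier A \<and> a \<noteq> \<one>\<^bsub>A\<^esub>
                            | Inr b \<Rightarrow> b \<in> carrier B \<and> b \<noteq> \<one>\<^bsub>B\<^esub>) \<and>
     (\<forall>i. Suc i < length w \<longrightarrow> isl (w ! i) \<noteq> isl (w ! Suc i))"

fun fp_push :: "('a, 'c) monoid_scheme \<Rightarrow> ('b, 'd) monoid_scheme \<Rightarrow> ('a + 'b) \<Rightarrow> ('a + 'b) list \<Rightarrow> ('a + 'b) list" where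
  "fp_push A B (Inl a) [] = (if a = \<one>\<^bsub>A\<^esub> then [] else [Inl a])"
| "fp_push A B (Inr b) [] = (if b = \<one>\<^bsub>B\<^esub> then [] else [Inr b])"
| "fp_push A B (Inl a) (Inl a' # w) =
     (let c = a \<otimes>\<^bsub>A\<^esub> a' in if c = \<one>\<^bsub>A\<^esub> then w else Inl c # w)"
| "fp_push A B (Inr b) (Inr b' # w) =
     (let c = b \<otimes>\<^bsub>B\<^esub> b' in if c = \<one>\<^bsub>B\<^esub> then w else Inr c # w)"
| "fp_push A B (Inl a) (Inr b # w) =
     (if a = \<one>\<^bsub>A\<^esub> then Inr b # w else Inl a # Inr b # w)"
| "fp_push A B (Inr b) (Inl a # w) =
     (if b = \<one>\<^bsub>B\<^esub> then Inl a # w else Inr b # Inl a # w)"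

definition free_product :: "('a, 'c) monoid_scheme \<Rightarrow> ('b, 'd) monoid_scheme \<Rightarrow> ('a + 'b) list monoid" where
  "free_product A B =
     \<lparr> carrier = {w. fp_reduced A B w},
       mult = (\<lambda>u v. foldr (fp_push A B) u v),
       one = [] \<rparr>"

definition fp_inl :: "('a, 'c) monoid_scheme \<Rightarrow> 'a \<Rightarrow> ('a + 'b) list" where
  "fp_inl A a = (if a = \<one>\<^bsub>A\<^esub> then [] else [Inl a])"

definition fp_inr :: "('b, 'd) monoid_scheme \<Rightarrow> 'b \<Rightarrow> ('a + 'b) list" where
  "fp_inr B b = (if b = \<one>\<^bsub>B\<^esub> then [] else [Inr b])"

definition mprod :: "('g, 'c) monoid_scheme \<Rightarrow> 'g list \<Rightarrow> 'g" where
  "mprod G xs = foldr (\<lambda>x y. x \<otimes>\<^bsub>G\<^esub> y) xs \<one>\<^bsub>G\<^esub>"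

definition commutator :: "('g, 'c) monoid_scheme \<Rightarrow> 'g \<Rightarrow> 'g \<Rightarrow> 'g" where
  "commutator G a b = a \<otimes>\<^bsub>G\<^esub> b \<otimes>\<^bsub>G\<^esub> inv\<^bsub>G\<^esub> a \<otimes>\<^bsub>G\<^esub> inv\<^bsub>G\<^esub> b"

definition comm_length :: "('g, 'c) monoid_scheme \<Rightarrow> 'g \<Rightarrow> nat" where
  "comm_length G h = (LEAST n. \<exists>a b. (\<forall>i<n. a i \<in> carrier G \<and> b i \<in> carrier G) \<and>
       h = mprod G (map (\<lambda>i. commutator G (a i) (b i)) [0..<n]))"

definition scl :: "('g, 'c) monoid_scheme \<Rightarrow> 'g \<Rightarrow> real" where
  "scl G g = lim (\<lambda>n. real (comm_length G (g [^]\<^bsub>G\<^esub> n)) / real n)"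

text \<open>1/N, where N is the minimum of the orders of the letters
(group.ord gives 0 for elements of infinite order), with 1/\<infinity> = 0.\<close>

definition inv_min_order :: "('a, 'c) monoid_scheme \<Rightarrow> ('b, 'd) monoid_scheme \<Rightarrow> nat \<Rightarrow> (nat \<Rightarrow> 'a) \<Rightarrow> (nat \<Rightarrow> 'b) \<Rightarrow> real" where
  "inv_min_order A B L as bs =
     (let F = ({group.ord A (as i) | i. i < L} \<union> {group.ord B (bs i) | i. i < L}) - {0}
      in if F = {} then 0 else 1 / real (Min F))"

end

theory Submission
  imports Defs
begin

text \<open>
  If \<open>g\<^sup>n\<close> is a product of \<open>k\<close> commutators with entries \<open>x\<^sub>1, \<dots>, x\<^sub>m\<close>, where \<open>m = 2k\<close>, then
  \<open>g\<^sup>n\<close> followed by the words \<open>x\<^sub>i\<close> and their inverses, in some order, is a trivial word. It bounds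
  a disk mapping to the classifying space of the free product, and the preimage of the wedge point cuts
  this disk into cells whose boundaries are trivial products in one of the factors. Gluing \<open>x\<^sub>i\<close> to
  its inverse letter by letter gives a surface with boundary \<open>g\<^sup>n\<close>, cut along arcs. Every gluing
  destroys at most one disk cell, which leaves at least \<open>nL + 1 - m\<close> of them.

  Each arc of the cut surface is a turn \<open>a\<^sub>i \<rightarrow> a\<^sub>j\<close> of a cell in \<open>A\<close> and a turn from
  \<open>b\<^sub>j\<^sub>-\<^sub>1\<close> to \<open>b\<^sub>i\<close> of a cell in \<open>B\<close>. Let an increasing turn cost \<open>1 - 1/N\<close> and any other turn
  \<open>1/N\<close>. A disk cell costs at least 1: either it has an ascent and a descent, or it is a power of a
  single letter and has at least \<open>N\<close> turns. An arc costs 1 altogether, except that it costs only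
  \<open>2/N\<close> where a new period of \<open>g\<close> begins. So there are at most \<open>n(L - 1) + 2n/N\<close> disk cells,
  whence \<open>2k \<ge> n(1 - 2/N)\<close>.
\<close>

section \<open>Products of lists of group elements\<close>

lemma successively_iff_nth:
  "successively P xs \<longleftrightarrow> (\<forall>i. Suc i < length xs \<longrightarrow> P (xs ! i) (xs ! Suc i))"
proof (induction P xs rule: successively.induct)
  case (3 P x y xs)
  show ?case
    unfolding successively.simps 3 by (auto simp: nth_Cons split: nat.splits)
qed auto

lemma mprod_Nil [simp]: "mprod G [] = \<one>\<^bsub>G\<^esub>"
  and mprod_Cons [simp]: "mprod G (x # xs) = x \<otimes>\<^bsub>G\<^esub> mprod G xs"
  by (simp_all add: mprod_def)

context group
begin

lemma mprod_closed [simp, intro]: "set xs \<subseteq> carrier G \<Longrightarrow> mprod G xs \<in> carrier G"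
  by (induction xs) auto

lemma mprod_append:
  "set xs \<subseteq> carrier G \<Longrightarrow> set ys \<subseteq> carrier G \<Longrightarrow> mprod G (xs @ ys) = mprod G xs \<otimes> mprod G ys"
  by (induction xs) (auto simp: m_assoc)

text \<open>Two elements with product \<open>\<one>\<close> are inverse to each other and commute.
  Hence the boundary of a cell may be read from any of its letters.\<close>

lemma mprod_rotate_eq_one:
  assumes "set xs \<subseteq> carrier G" "set ys \<subseteq> carrier G" "mprod G (xs @ ys) = \<one>"
  shows "mprod G (ys @ xs) = \<one>"
  using assms inv_comm[of "mprod G xs" "mprod G ys"] by (simp add: mprod_append)

lemma mprod_inv:
  "set xs \<subseteq> carrier G \<Longrightarrow> mprod G (rev (map (\<lambda>x. inv x) xs)) = inv (mprod G xs)"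
proof (induction xs)
  case (Cons x xs)
  then have "set (rev (map (\<lambda>x. inv x) xs)) \<subseteq> carrier G" by auto
  with Cons show ?case by (simp add: mprod_append inv_mult_group)
qed simp

lemma mprod_replicate: "x \<in> carrier G \<Longrightarrow> mprod G (replicate n x) = x [^] n"
proof (induction n)
  case (Suc n)
  then show ?case using nat_pow_Suc2[of x n] by (simp del: nat_pow_Suc)
qed simp

lemma mprod_concat:
  "(\<And>xs. xs \<in> set xss \<Longrightarrow> set xs \<subseteq> carrier G) \<Longrightarrow>
   mprod G (concat xss) = mprod G (map (mprod G) xss)"
proof (induction xss)
  case (Cons xs xss)
  then have "set (concat xss) \<subseteq> carrier G" "set xs \<subseteq> carrier G" by auto
  with Cons show ?case by (simp add: mprod_append)
qed simp

lemma mprod_subgroup: "subgroup H G \<Longrightarrow> set xs \<subseteq> H \<Longrightarrow> mprod G xs \<in> H"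
  by (induction xs) (auto intro: subgroup.m_closed subgroup.one_closed)

end

section \<open>The free product as a group\<close>

fun fp_letter :: "('a, 'c) monoid_scheme \<Rightarrow> ('b, 'd) monoid_scheme \<Rightarrow> 'a + 'b \<Rightarrow> bool" where
  "fp_letter A B (Inl a) \<longleftrightarrow> a \<in> carrier A"
| "fp_letter A B (Inr b) \<longleftrightarrow> b \<in> carrier B"

fun fp_nontriv :: "('a, 'c) monoid_scheme \<Rightarrow> ('b, 'd) monoid_scheme \<Rightarrow> 'a + 'b \<Rightarrow> bool" where
  "fp_nontriv A B (Inl a) \<longleftrightarrow> a \<noteq> \<one>\<^bsub>A\<^esub>"
| "fp_nontriv A B (Inr b) \<longleftrightarrow> b \<noteq> \<one>\<^bsub>B\<^esub>"

fun fp_linv :: "('a, 'c) monoid_scheme \<Rightarrow> ('b, 'd) monoid_scheme \<Rightarrow> 'a + 'b \<Rightarrow> 'a + 'b" where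
  "fp_linv A B (Inl a) = Inl (inv\<^bsub>A\<^esub> a)"
| "fp_linv A B (Inr b) = Inr (inv\<^bsub>B\<^esub> b)"

lemma fp_reduced_iff:
  "fp_reduced A B w \<longleftrightarrow>
     (\<forall>x\<in>set w. fp_letter A B x \<and> fp_nontriv A B x) \<and> successively (\<lambda>x y. isl x \<noteq> isl y) w"
  unfolding fp_reduced_def successively_iff_nth
  by (intro arg_cong2[where f="(\<and>)"] ball_cong refl) (auto split: sum.splits)

lemma fp_reduced_Nil [simp]: "fp_reduced A B []"
  by (simp add: fp_reduced_iff)

lemma fp_reduced_Cons:
  "fp_reduced A B (x # w) \<longleftrightarrow> fp_letter A B x \<and> fp_nontriv A B x \<and> fp_reduced A B w \<and>
     (w = [] \<or> isl x \<noteq> isl (hd w))"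
  unfolding fp_reduced_iff successively_Cons by auto

locale free_product_groups = A: group A + B: group B
  for A :: "('a, 'c) monoid_scheme" and B :: "('b, 'd) monoid_scheme"
begin

abbreviation "red \<equiv> fp_reduced A B"
abbreviation "push \<equiv> fp_push A B"
abbreviation "FP \<equiv> free_product A B"

lemma push_reduced: "fp_letter A B l \<Longrightarrow> red w \<Longrightarrow> red (push l w)"
  by (cases l; cases w; cases "hd w"; auto simp: fp_reduced_Cons Let_def)

lemma push_Cons_reduced: "red (l # w) \<Longrightarrow> push l w = l # w"
  by (induction A B l w rule: fp_push.induct) (auto simp: fp_reduced_Cons)

lemma push_one [simp]: "red w \<Longrightarrow> push (Inl \<one>\<^bsub>A\<^esub>) w = w" "red w \<Longrightarrow> push (Inr \<one>\<^bsub>B\<^esub>) w = w"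
  by (cases w; cases "hd w"; auto simp: fp_reduced_Cons)+

text \<open>Pushing is an action of the factor on reduced words; associativity of the free product
  rests on it. If \<open>a'\<close> cancels the first letter, the rest \<open>u\<close> does not
  begin in the same factor, so pushing another letter onto it causes no merging.\<close>

lemma push_push_Inl:
  assumes "a \<in> carrier A" "a' \<in> carrier A" "red w"
  shows "push (Inl a) (push (Inl a') w) = push (Inl (a \<otimes>\<^bsub>A\<^esub> a')) w"
proof (cases w)
  case Nil
  then show ?thesis using assms by (auto simp: Let_def)
next
  case (Cons x u)
  show ?thesis
  proof (cases x)
    case (Inr b)
    then show ?thesis using assms Cons by (auto simp: Let_def)
  next
    case (Inl c)
    have u: "red u" "u = [] \<or> \<not> isl (hd u)" and c: "c \<in> carrier A" "c \<noteq> \<one>\<^bsub>A\<^esub>"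
      using assms(3) Cons Inl by (auto simp: fp_reduced_Cons)
    have skip: "push (Inl y) u = (if y = \<one>\<^bsub>A\<^esub> then u else Inl y # u)" for y
      using u by (cases u; cases "hd u") auto
    show ?thesis
    proof (cases "a' \<otimes>\<^bsub>A\<^esub> c = \<one>\<^bsub>A\<^esub>")
      case True
      have "a \<otimes>\<^bsub>A\<^esub> a' \<otimes>\<^bsub>A\<^esub> c = a"
        using True assms c by (simp add: A.m_assoc)
      then show ?thesis using True Cons Inl skip by (simp add: Let_def)
    next
      case False
      then show ?thesis using assms c Cons Inl by (simp add: Let_def A.m_assoc)
    qed
  qed
qed

lemma push_push_Inr:
  assumes "a \<in> carrier B" "a' \<in> carrier B" "red w"
  shows "push (Inr a) (push (Inr a') w) = push (Inr (a \<otimes>\<^bsub>B\<^esub> a')) w"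
proof (cases w)
  case Nil
  then show ?thesis using assms by (auto simp: Let_def)
next
  case (Cons x u)
  show ?thesis
  proof (cases x)
    case (Inl b)
    then show ?thesis using assms Cons by (auto simp: Let_def)
  next
    case (Inr c)
    have u: "red u" "u = [] \<or> isl (hd u)" and c: "c \<in> carrier B" "c \<noteq> \<one>\<^bsub>B\<^esub>"
      using assms(3) Cons Inr by (auto simp: fp_reduced_Cons)
    have skip: "push (Inr y) u = (if y = \<one>\<^bsub>B\<^esub> then u else Inr y # u)" for y
      using u by (cases u; cases "hd u") auto
    show ?thesis
    proof (cases "a' \<otimes>\<^bsub>B\<^esub> c = \<one>\<^bsub>B\<^esub>")
      case True
      have "a \<otimes>\<^bsub>B\<^esub> a' \<otimes>\<^bsub>B\<^esub> c = a"
        using True assms c by (simp add: B.m_assoc)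
      then show ?thesis using True Cons Inr skip by (simp add: Let_def)
    next
      case False
      then show ?thesis using assms c Cons Inr by (simp add: Let_def B.m_assoc)
    qed
  qed
qed

lemma foldr_push_reduced: "red x \<Longrightarrow> \<forall>l\<in>set u. fp_letter A B l \<Longrightarrow> red (foldr push u x)"
  by (induction u) (auto intro: push_reduced)

lemma red_letters: "red u \<Longrightarrow> \<forall>l\<in>set u. fp_letter A B l"
  by (auto simp: fp_reduced_iff)

text \<open>Associativity with a single letter on the left. When \<open>l\<close> merges with the
  first letter of \<open>v\<close>, this is the action property of the factor.\<close>

lemma foldr_push_push:
  assumes "fp_letter A B l" "red v" "red x"
  shows "foldr push (push l v) x = push l (foldr push v x)"
proof -
  have fr: "red (foldr push u x)" if "red u" for u
    using that foldr_push_reduced red_letters assms(3) by blast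
  show ?thesis
  proof (cases l)
    case (Inl a)
    show ?thesis
    proof (cases v)
      case Nil
      then show ?thesis using Inl assms by auto
    next
      case (Cons y u)
      have u: "red u" using assms Cons by (simp add: fp_reduced_Cons)
      show ?thesis
        using assms Inl Cons fr[OF u] fr[of v] push_push_Inl[of a _ "foldr push u x"]
        by (cases y) (auto simp: Let_def fp_reduced_Cons)
    qed
  next
    case (Inr a)
    show ?thesis
    proof (cases v)
      case Nil
      then show ?thesis using Inr assms by auto
    next
      case (Cons y u)
      have u: "red u" using assms Cons by (simp add: fp_reduced_Cons)
      show ?thesis
        using assms Inr Cons fr[OF u] fr[of v] push_push_Inr[of a _ "foldr push u x"]
        by (cases y) (auto simp: Let_def fp_reduced_Cons)
    qed
  qed
qed

lemma foldr_push_assoc: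
  assumes "\<forall>l\<in>set u. fp_letter A B l" "red v" "red x"
  shows "foldr push (foldr push u v) x = foldr push u (foldr push v x)"
  using assms(1)
proof (induction u)
  case (Cons l u)
  then show ?case
    using foldr_push_push[of l "foldr push u v" x] foldr_push_reduced[of v u] assms by auto
qed simp

lemma carrier_FP: "carrier FP = {w. red w}"
  and one_FP: "\<one>\<^bsub>FP\<^esub> = []"
  and mult_FP: "u \<otimes>\<^bsub>FP\<^esub> v = foldr push u v"
  by (simp_all add: free_product_def)

lemma linv_letter: "fp_letter A B l \<Longrightarrow> fp_letter A B (fp_linv A B l)"
  by (cases l) auto

lemma push_linv:
  assumes "fp_letter A B l" "red w"
  shows "push (fp_linv A B l) (push l w) = w"
  using assms push_push_Inl push_push_Inr by (cases l) auto

text \<open>The inverse is assembled letter by letter: a left inverse of the tail, multiplied by the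
  one-letter inverse \<open>i\<close> of the head.\<close>

lemma ex_left_inverse: "red u \<Longrightarrow> \<exists>u'. red u' \<and> foldr push u' u = []"
proof (induction u)
  case Nil
  show ?case by (rule exI[of _ "[]"]) simp
next
  case (Cons l u)
  then obtain u' where u': "red u'" "foldr push u' u = []"
    by (auto simp: fp_reduced_Cons)
  have l: "fp_letter A B l" "red u" using Cons.prems by (auto simp: fp_reduced_Cons)
  define i where "i = push (fp_linv A B l) []"
  have i: "red i" unfolding i_def using push_reduced linv_letter l by simp
  have "foldr push i (l # u) = push (fp_linv A B l) (l # u)"
    unfolding i_def using foldr_push_push[of "fp_linv A B l" "[]" "l # u"] linv_letter l Cons.prems by simp
  also have "\<dots> = u"
    using push_linv[OF l] push_Cons_reduced[OF Cons.prems] by simp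
  finally have "foldr push (foldr push u' i) (l # u) = []"
    using foldr_push_assoc[of u' i "l # u"] u' i Cons.prems red_letters by simp
  moreover have "red (foldr push u' i)" using foldr_push_reduced i u' red_letters by blast
  ultimately show ?case by blast
qed

lemma group_FP: "group FP"
proof (rule groupI)
  fix x y assume "x \<in> carrier FP" "y \<in> carrier FP"
  then show "x \<otimes>\<^bsub>FP\<^esub> y \<in> carrier FP"
    using foldr_push_reduced red_letters by (auto simp: carrier_FP mult_FP)
next
  fix x y z assume "x \<in> carrier FP" "y \<in> carrier FP" "z \<in> carrier FP"
  then show "x \<otimes>\<^bsub>FP\<^esub> y \<otimes>\<^bsub>FP\<^esub> z = x \<otimes>\<^bsub>FP\<^esub> (y \<otimes>\<^bsub>FP\<^esub> z)"
    using foldr_push_assoc red_letters by (auto simp: carrier_FP mult_FP)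
next
  fix x assume "x \<in> carrier FP"
  then show "\<exists>y\<in>carrier FP. y \<otimes>\<^bsub>FP\<^esub> x = \<one>\<^bsub>FP\<^esub>"
    using ex_left_inverse[of x] by (auto simp: carrier_FP mult_FP one_FP)
qed (auto simp: carrier_FP mult_FP one_FP)

text \<open>In a reduced word no push merges letters. As the identity is the empty list, this is the
  normal form theorem: a nonempty reduced product is nontrivial.\<close>

lemma mprod_letters:
  "red w \<Longrightarrow> mprod FP (map (\<lambda>l. push l []) w) = w"
proof (induction w)
  case (Cons l w)
  have "push l [] = [l]" using Cons.prems by (cases l) (auto simp: fp_reduced_Cons)
  with Cons show ?case by (simp add: mult_FP push_Cons_reduced fp_reduced_Cons)
qed (simp add: one_FP)

lemma group_hom_inl: "group_hom A FP (fp_inl A)"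
proof (intro group_hom.intro group_hom_axioms.intro homI)
  fix x y assume "x \<in> carrier A" "y \<in> carrier A"
  then show "fp_inl A (x \<otimes>\<^bsub>A\<^esub> y) = fp_inl A x \<otimes>\<^bsub>FP\<^esub> fp_inl A y"
    using push_push_Inl[of x y "[]"] by (auto simp: mult_FP fp_inl_def)
qed (auto simp: group_FP A.is_group carrier_FP fp_inl_def fp_reduced_Cons)

lemma group_hom_inr: "group_hom B FP (fp_inr B)"
proof (intro group_hom.intro group_hom_axioms.intro homI)
  fix x y assume "x \<in> carrier B" "y \<in> carrier B"
  then show "fp_inr B (x \<otimes>\<^bsub>B\<^esub> y) = fp_inr B x \<otimes>\<^bsub>FP\<^esub> fp_inr B y"
    using push_push_Inr[of x y "[]"] by (auto simp: mult_FP fp_inr_def)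
qed (auto simp: group_FP B.is_group carrier_FP fp_inr_def fp_reduced_Cons)

end

text \<open>An internal free product of the two subgroups \<^term>\<open>H True\<close> and \<^term>\<open>H False\<close>.\<close>

locale free_factors = group G for G :: "('g, 'm) monoid_scheme" (structure) +
  fixes H :: "bool \<Rightarrow> 'g set"
  assumes sub: "subgroup (H s) G"
    and alternating_ne_one: "xs \<noteq> [] \<Longrightarrow> successively (\<lambda>x y. fst x \<noteq> fst y) xs \<Longrightarrow>
      (\<And>s x. (s, x) \<in> set xs \<Longrightarrow> x \<in> H s \<and> x \<noteq> \<one>) \<Longrightarrow> mprod G (map snd xs) \<noteq> \<one>"
    and ex_alternating: "x \<in> carrier G \<Longrightarrow> \<exists>xs. successively (\<lambda>x y. fst x \<noteq> fst y) xs \<and>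
      (\<forall>(s, x)\<in>set xs. x \<in> H s \<and> x \<noteq> \<one>) \<and> mprod G (map snd xs) = x"

context free_product_groups
begin

lemma free_factors_FP:
  "free_factors FP (\<lambda>s. if s then fp_inl A ` carrier A else fp_inr B ` carrier B)"
    (is "free_factors FP ?H")
proof (intro free_factors.intro free_factors_axioms.intro)
  show "group FP" by (rule group_FP)
  show "subgroup (?H s) FP" for s
    using group_hom.img_is_subgroup[OF group_hom_inl] group_hom.img_is_subgroup[OF group_hom_inr]
    by simp
next
  fix xs :: "(bool \<times> ('a + 'b) list) list"
  assume ne: "xs \<noteq> []" and alt: "successively (\<lambda>x y. fst x \<noteq> fst y) xs"
    and nt: "\<And>s x. (s, x) \<in> set xs \<Longrightarrow> x \<in> ?H s \<and> x \<noteq> \<one>\<^bsub>FP\<^esub>"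
  \<comment> \<open>A nontrivial element of an embedded factor is a one-letter word, so an
    alternating list spells a reduced word.\<close>
  have single: "snd p = [hd (snd p)] \<and> isl (hd (snd p)) = fst p \<and> fp_letter A B (hd (snd p)) \<and>
      fp_nontriv A B (hd (snd p))" if "p \<in> set xs" for p
  proof -
    obtain s x where p: "p = (s, x)" by force
    show ?thesis using nt[of s x] that unfolding p
      by (cases s) (auto simp: one_FP fp_inl_def fp_inr_def split: if_splits)
  qed
  define w where "w = map (\<lambda>p. hd (snd p)) xs"
  have "successively (\<lambda>p q. isl (hd (snd p)) \<noteq> isl (hd (snd q))) xs"
    by (rule successively_mono[OF alt]) (use single in auto)
  then have w: "red w"
    using single unfolding fp_reduced_iff w_def successively_map by auto
  have "push (hd (snd p)) [] = snd p" if "p \<in> set xs" for p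
  proof -
    have "push (hd (snd p)) [] = [hd (snd p)]"
      using single[OF that] by (cases "hd (snd p)") auto
    then show ?thesis using single[OF that] by simp
  qed
  then have "map (\<lambda>l. push l []) w = map snd xs"
    unfolding w_def by (simp cong: map_cong)
  then have "mprod FP (map snd xs) = w" using mprod_letters[OF w] by simp
  with ne show "mprod FP (map snd xs) \<noteq> \<one>\<^bsub>FP\<^esub>" by (simp add: one_FP w_def)
next
  fix x assume "x \<in> carrier FP"
  then have x: "red x" by (simp add: carrier_FP)
  define xs where "xs = map (\<lambda>l. (isl l, push l [])) x"
  have "successively (\<lambda>x y. fst x \<noteq> fst y) xs"
    using x unfolding xs_def successively_map fp_reduced_iff by simp
  moreover have "y \<in> ?H s \<and> y \<noteq> \<one>\<^bsub>FP\<^esub>" if "(s, y) \<in> set xs" for s y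
  proof -
    from that obtain l where l: "l \<in> set x" "s = isl l" "y = push l []" by (auto simp: xs_def)
    then have "fp_letter A B l" "fp_nontriv A B l" using x by (auto simp: fp_reduced_iff)
    then show ?thesis using l by (cases l) (auto simp: one_FP fp_inl_def fp_inr_def)
  qed
  moreover have "mprod FP (map snd xs) = x"
    unfolding xs_def using mprod_letters[OF x] by (simp add: comp_def)
  ultimately show "\<exists>xs. successively (\<lambda>x y. fst x \<noteq> fst y) xs \<and>
      (\<forall>(s, x)\<in>set xs. x \<in> ?H s \<and> x \<noteq> \<one>\<^bsub>FP\<^esub>) \<and> mprod FP (map snd xs) = x"
    by blast
qed

end

section \<open>Cutting a disk along chords\<close>

definition cyclically :: "('t \<Rightarrow> 't \<Rightarrow> bool) \<Rightarrow> 't list \<Rightarrow> bool" where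
  "cyclically R c \<longleftrightarrow> c \<noteq> [] \<and> successively R c \<and> R (last c) (hd c)"

text \<open>Serves to cut off the side \<open>y\<close>: its neighbours \<open>x\<close> and
  \<open>z\<close> join to a side \<open>w\<close> that begins like \<open>x\<close> and ends like
  \<open>z\<close>.\<close>

lemma successively_merge:
  assumes "successively R (P @ x # y # z # Q)" "\<And>a. R a x \<Longrightarrow> R a w" "\<And>b. R z b \<Longrightarrow> R w b"
  shows "successively R (P @ w # Q)"
  using assms by (cases Q) (auto simp: successively_append_iff)

lemma cyclically_mono: "cyclically R c \<Longrightarrow> (\<And>x y. R x y \<Longrightarrow> S x y) \<Longrightarrow> cyclically S c"
  unfolding cyclically_def by (auto intro: successively_mono)

lemma cyclically_rotate: "cyclically R (xs @ ys) \<Longrightarrow> cyclically R (ys @ xs)"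
  unfolding cyclically_def successively_append_iff
  by (cases "xs = []"; cases "ys = []") auto

definition homog :: "('t \<Rightarrow> bool) \<Rightarrow> 't list \<Rightarrow> bool" where
  "homog tp c \<longleftrightarrow> (\<exists>t. \<forall>x\<in>set c. tp x = t)"

lemma homog_hd: "homog tp c \<Longrightarrow> x \<in> set c \<Longrightarrow> tp x = tp (hd c)"
  unfolding homog_def by (cases c) auto

lemma homog_append: "homog tp (xs @ ys) \<longleftrightarrow>
    homog tp xs \<and> homog tp ys \<and> (xs \<noteq> [] \<longrightarrow> ys \<noteq> [] \<longrightarrow> tp (hd xs) = tp (hd ys))"
  unfolding homog_def by (cases xs; cases ys) auto

lemma homog_Cons: "homog tp (x # xs) \<longleftrightarrow> homog tp xs \<and> (xs \<noteq> [] \<longrightarrow> tp x = tp (hd xs))"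
  using homog_append[of tp "[x]" xs] by (auto simp: homog_def)

lemma distinct_concat_split:
  assumes "distinct (concat Cs)" "e \<in> set (concat Cs)"
  obtains l c r where "Cs = l @ c # r" "e \<in> set c" "e \<notin> set (concat (l @ r))"
proof -
  obtain c where c: "c \<in> set Cs" "e \<in> set c" using assms(2) by auto
  obtain l r where "Cs = l @ c # r" using split_list[OF c(1)] by blast
  then show thesis using that[of l c r] assms(1) c by auto
qed

context free_factors
begin

text \<open>A disk mapping to a single factor, described by the letters around its boundary;
  \<open>R\<close> tells which letter may follow which.\<close>

definition cell :: "('t \<Rightarrow> bool) \<Rightarrow> ('t \<Rightarrow> 'g) \<Rightarrow> ('t \<Rightarrow> 't \<Rightarrow> bool) \<Rightarrow> 't list \<Rightarrow> bool" where
  "cell tp v R c \<longleftrightarrow> cyclically R c \<and> mprod G (map v c) = \<one> \<and> homog tp c"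

lemma cell_mono: "cell tp v R c \<Longrightarrow> (\<And>x y. R x y \<Longrightarrow> S x y) \<Longrightarrow> cell tp v S c"
  unfolding cell_def using cyclically_mono by blast

lemma H_carrier: "x \<in> H s \<Longrightarrow> x \<in> carrier G"
  using subgroup.mem_carrier[OF sub] .

text \<open>Otherwise, omitting the first or last side where it is trivial would leave a nonempty
  alternating product of nontrivial elements, equal to the identity. Asking for an interior side
  avoids wrapping around the ends of the list.\<close>

lemma ex_interior_trivial:
  assumes ne: "length SS \<ge> 3" "\<forall>S\<in>set SS. S \<noteq> []"
    and hom: "\<forall>S\<in>set SS. homog tp S"
    and alt: "successively (\<lambda>S S'. tp (hd S) \<noteq> tp (hd S')) SS"
    and v: "\<forall>x\<in>set (concat SS). v x \<in> H (tp x)"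
    and one: "mprod G (map v (concat SS)) = \<one>"
  shows "\<exists>P S1 S2 S3 Q. SS = P @ S1 # S2 # S3 # Q \<and> mprod G (map v S2) = \<one>"
proof (rule ccontr)
  assume neg: "\<not> ?thesis"
  define p where "p S = mprod G (map v S)" for S
  obtain S0 mid Sr where SS: "SS = S0 # mid @ [Sr]" "mid \<noteq> []"
  proof -
    obtain S0 T where T: "SS = S0 # T" using ne by (cases SS) auto
    then have "T \<noteq> []" using ne by auto
    then obtain mid Sr where "T = mid @ [Sr]" by (metis rev_exhaust)
    with T that show thesis using ne by force
  qed
  have pH: "p S \<in> H (tp (hd S))" if "S \<in> set SS" for S
  proof -
    have "set (map v S) \<subseteq> H (tp (hd S))"
    proof
      fix y assume "y \<in> set (map v S)"
      then obtain x where x: "x \<in> set S" "y = v x" by auto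
      have "tp x = tp (hd S)" by (rule homog_hd[OF hom[rule_format, OF that] x(1)])
      moreover have "v x \<in> H (tp x)" using v x that by auto
      ultimately show "y \<in> H (tp (hd S))" using x by simp
    qed
    then show ?thesis unfolding p_def using mprod_subgroup sub by blast
  qed
  have mid: "p S \<noteq> \<one>" if S_mid: "S \<in> set mid" for S
  proof
    assume S: "p S = \<one>"
    obtain l r where lr: "mid = l @ S # r" using split_list[OF S_mid] by blast
    show False
    proof (cases "l = []"; cases "r = []")
      assume "l = []" "r = []"
      with neg S SS lr show False unfolding p_def by (metis append.left_neutral append_Cons)
    next
      assume "l = []" "r \<noteq> []"
      then have "SS = [] @ S0 # S # hd r # (tl r @ [Sr])" using SS lr by simp
      with neg S show False unfolding p_def by blast
    next
      assume "l \<noteq> []" "r = []"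
      then have "SS = (S0 # butlast l) @ last l # S # Sr # []" using SS lr by simp
      with neg S show False unfolding p_def by blast
    next
      assume "l \<noteq> []" "r \<noteq> []"
      then have "SS = (S0 # butlast l) @ last l # S # hd r # (tl r @ [Sr])" using SS lr by simp
      with neg S show False unfolding p_def by blast
    qed
  qed
  define TT where "TT = (if p S0 = \<one> then [] else [S0]) @ mid @ (if p Sr = \<one> then [] else [Sr])"
  have sub_TT: "set TT \<subseteq> set SS" unfolding TT_def using SS by auto
  have "successively (\<lambda>S S'. tp (hd S) \<noteq> tp (hd S')) TT"
    using alt SS unfolding TT_def by (auto simp: successively_Cons successively_append_iff)
  then have "successively (\<lambda>x y. fst x \<noteq> fst y) (map (\<lambda>S. (tp (hd S), p S)) TT)"
    unfolding successively_map by simp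
  moreover have "TT \<noteq> []" using SS(2) by (simp add: TT_def)
  moreover have "p S \<noteq> \<one>" if "S \<in> set TT" for S
    using that mid by (auto simp: TT_def split: if_splits)
  ultimately have "mprod G (map snd (map (\<lambda>S. (tp (hd S), p S)) TT)) \<noteq> \<one>"
    using pH sub_TT by (intro alternating_ne_one) auto
  moreover have carr: "p S \<in> carrier G" if "S \<in> set SS" for S
    using pH[OF that] H_carrier by blast
  have "mprod G (map p TT) = mprod G (map p SS)"
  proof -
    have "set (map p mid) \<subseteq> carrier G" "p S0 \<in> carrier G" "p Sr \<in> carrier G"
      using carr SS by auto
    then show ?thesis unfolding TT_def SS(1) by (auto simp: mprod_append)
  qed
  moreover have "mprod G (map p SS) = mprod G (map v (concat SS))"
  proof -
    have "set xs \<subseteq> carrier G" if "xs \<in> set (map (map v) SS)" for xs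
      using that v H_carrier by fastforce
    then show ?thesis using mprod_concat[of "map (map v) SS"]
      unfolding map_concat p_def by (simp add: comp_def)
  qed
  ultimately show False using one by (simp add: comp_def)
qed

text \<open>The sides are the maximal blocks of letters of one type on the boundary of a polygon
  mapping to the free product. A side of trivial product is cut off by a chord, which joins the two
  switching points at its ends; \<^term>\<open>M\<close> is the resulting matching of switching points, each
  of them named by the letter \<^term>\<open>x\<close> before it, so that \<^term>\<open>\<sigma> x\<close> is the letter after it.\<close>

lemma planar_cells:
  assumes "odd (length SS)" "\<forall>S\<in>set SS. S \<noteq> []" "distinct (concat SS)"
    and "\<forall>S\<in>set SS. homog tp S"
    and "successively (\<lambda>S S'. tp (hd S) \<noteq> tp (hd S')) SS"
    and "successively (\<lambda>S S'. hd S' = \<sigma> (last S)) SS"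
    and "\<forall>S\<in>set SS. successively I S" "I (last (last SS)) (hd (hd SS))"
    and "\<forall>x\<in>set (concat SS). v x \<in> H (tp x)"
    and "mprod G (map v (concat SS)) = \<one>"
  shows "\<exists>Rs M. mset (concat Rs) = mset (concat SS) \<and> 2 * length Rs = length SS + 1 \<and>
    (\<forall>c\<in>set Rs. cell tp v (\<lambda>x y. I x y \<or> (\<exists>u. M x u \<and> y = \<sigma> u)) c) \<and>
    symp M \<and> right_unique M \<and> (\<forall>x u. M x u \<longrightarrow> x \<in> last ` set (butlast SS))"
  using assms
proof (induction "length SS" arbitrary: SS I rule: less_induct)
  case less
  note prems = less.prems
  show ?case
  proof (cases "length SS \<ge> 3")
    \<comment> \<open>An odd number of sides below 3 is a single side, which closes up to the last
      cell.\<close>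
    case False
    then have "length SS = 1"
      using prems(1) by presburger
    then obtain S where S: "SS = [S]" by (cases SS) auto
    have "cell tp v I S"
      unfolding cell_def cyclically_def
      using prems(2) prems(4) prems(7) prems(8) prems(10) unfolding S by simp
    then have "cell tp v (\<lambda>x y. I x y \<or> (\<exists>u. False \<and> y = \<sigma> u)) S" by simp
    then show ?thesis
      using S by (intro exI[of _ "[S]"] exI[of _ "\<lambda>_ _. False"])
        (auto simp: symp_def right_unique_def)
  next
    case True
    obtain P S1 S2 S3 Q where SS: "SS = P @ S1 # S2 # S3 # Q" and S2: "mprod G (map v S2) = \<one>"
      using ex_interior_trivial[OF True prems(2,4,5,9,10)] by blast
    define u where "u = last S1"
    define u' where "u' = last S2"
    \<comment> \<open>Once \<open>S2\<close> is cut off, the chord leads from the end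
      \<open>u\<close> of \<open>S1\<close> directly to \<open>\<sigma> u'\<close>, the start of
      \<open>S3\<close>.\<close>
    define I' where "I' x y \<longleftrightarrow> I x y \<or> (x = u \<and> y = \<sigma> u')" for x y
    define SS' where "SS' = P @ (S1 @ S3) # Q"
    have ne: "S1 \<noteq> []" "S2 \<noteq> []" "S3 \<noteq> []" using prems(2) SS by auto
    have hd2: "hd S2 = \<sigma> u" and hd3: "hd S3 = \<sigma> u'"
      using prems(6) ne unfolding SS u_def u'_def by (auto simp: successively_append_iff)
    have len: "length SS = length SS' + 2" unfolding SS SS'_def by simp
    have tp13: "tp (hd S1) = tp (hd S3)"
      using prems(5) unfolding SS by (auto simp: successively_append_iff)
    have vc: "v x \<in> carrier G" if "x \<in> set (concat SS)" for x
      using prems(9) that H_carrier by blast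
    have c1: "set (map v (concat P @ S1)) \<subseteq> carrier G" "set (map v S2) \<subseteq> carrier G"
      "set (map v (S3 @ concat Q)) \<subseteq> carrier G"
      using vc unfolding SS by auto
    have "mprod G (map v (concat SS)) =
        mprod G (map v (concat P @ S1) @ map v S2 @ map v (S3 @ concat Q))"
      unfolding SS by simp
    also have "\<dots> = mprod G (map v (concat P @ S1) @ map v (S3 @ concat Q))"
      using c1 S2 by (simp add: mprod_append del: map_append)
    also have "\<dots> = mprod G (map v (concat SS'))"
      unfolding SS'_def by simp
    finally have one': "mprod G (map v (concat SS')) = \<one>" using prems(10) by simp
    have lst: "last (last SS') = last (last SS)" "hd (hd SS') = hd (hd SS)"
      unfolding SS SS'_def using ne by (cases P; cases Q; auto)+
    have "\<exists>Rs M. mset (concat Rs) = mset (concat SS') \<and> 2 * length Rs = length SS' + 1 \<and>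
      (\<forall>c\<in>set Rs. cell tp v (\<lambda>x y. I' x y \<or> (\<exists>u. M x u \<and> y = \<sigma> u)) c) \<and>
      symp M \<and> right_unique M \<and> (\<forall>x u. M x u \<longrightarrow> x \<in> last ` set (butlast SS'))"
    proof (rule less.hyps)
      show "length SS' < length SS" using len by simp
      show "odd (length SS')" using prems(1) len by simp
      show "\<forall>S\<in>set SS'. S \<noteq> []" "distinct (concat SS')"
        using prems(2,3) unfolding SS SS'_def by auto
      show "\<forall>S\<in>set SS'. homog tp S"
        using prems(4) ne tp13 unfolding SS SS'_def by (auto simp: homog_append)
      show "successively (\<lambda>S S'. tp (hd S) \<noteq> tp (hd S')) SS'"
        unfolding SS'_def by (rule successively_merge[OF prems(5)[unfolded SS]])
          (simp_all add: ne tp13[symmetric])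
      show "successively (\<lambda>S S'. hd S' = \<sigma> (last S)) SS'"
        unfolding SS'_def by (rule successively_merge[OF prems(6)[unfolded SS]]) (simp_all add: ne)
      have "successively I' S" if "S \<in> set SS" for S
        by (rule successively_mono[OF prems(7)[rule_format, OF that]]) (simp add: I'_def)
      moreover have "I' (last S1) (hd S3)" using hd3 by (simp add: I'_def u_def)
      ultimately show "\<forall>S\<in>set SS'. successively I' S"
        unfolding SS SS'_def by (auto simp: successively_append_iff)
      show "I' (last (last SS')) (hd (hd SS'))" using prems(8) lst by (simp add: I'_def)
      show "\<forall>x\<in>set (concat SS'). v x \<in> H (tp x)" using prems(9) unfolding SS SS'_def by auto
      show "mprod G (map v (concat SS')) = \<one>" by (rule one')
    qed
    then obtain Rs M where Rs: "mset (concat Rs) = mset (concat SS')" "2 * length Rs = length SS' + 1"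
      "\<forall>c\<in>set Rs. cell tp v (\<lambda>x y. I' x y \<or> (\<exists>u. M x u \<and> y = \<sigma> u)) c"
      and M: "symp M" "right_unique M" "\<And>x u. M x u \<Longrightarrow> x \<in> last ` set (butlast SS')" by blast
    define M' where "M' x y \<longleftrightarrow> M x y \<or> (x = u \<and> y = u') \<or> (x = u' \<and> y = u)" for x y
    have uu: "u \<in> set S1" "u' \<in> set S2" using ne by (auto simp: u_def u'_def)
    \<comment> \<open>The matching of the shorter polygon uses only ends of its sides. Neither
      \<open>u\<close>, now inside the side \<open>S1 @ S3\<close>, nor \<open>u'\<close>, which was
      cut off, is such an end.\<close>
    have neM: "\<not> M u y \<and> \<not> M u' y" for y
    proof -
      have b: "butlast SS' = P @ (if Q = [] then [] else (S1 @ S3) # butlast Q)"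
        unfolding SS'_def by (simp add: butlast_append)
      have "x \<in> (\<Union>S\<in>set P. set S) \<union> set S3 \<union> (\<Union>S\<in>set Q. set S)" if Mxy: "M x y" for x
      proof -
        obtain S where S: "S \<in> set (butlast SS')" "x = last S" using M(3)[OF Mxy] by auto
        have "S \<noteq> []" using S prems(2) ne unfolding b SS by (auto split: if_splits dest: in_set_butlastD)
        then have "last S \<in> set S" by simp
        then show ?thesis using S ne unfolding b
          by (auto split: if_splits dest: in_set_butlastD)
      qed
      moreover have "u \<notin> (\<Union>S\<in>set P. set S) \<union> set S3 \<union> (\<Union>S\<in>set Q. set S)"
        "u' \<notin> (\<Union>S\<in>set P. set S) \<union> set S3 \<union> (\<Union>S\<in>set Q. set S)"
        using uu prems(3) unfolding SS by auto
      ultimately show ?thesis by blast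
    qed
    have uu': "u \<noteq> u'" using uu prems(3) unfolding SS by auto
    \<comment> \<open>The side cut off closes up along the other bank of the chord, from
      \<open>u'\<close> back to \<open>\<sigma> u\<close>.\<close>
    have "cell tp v (\<lambda>x y. I x y \<or> (\<exists>u. M' x u \<and> y = \<sigma> u)) S2"
      unfolding cell_def cyclically_def
    proof (intro conjI)
      have "successively I S2" using prems(7) SS by auto
      then show "successively (\<lambda>x y. I x y \<or> (\<exists>u. M' x u \<and> y = \<sigma> u)) S2"
        by (rule successively_mono) auto
      show "I (last S2) (hd S2) \<or> (\<exists>u. M' (last S2) u \<and> hd S2 = \<sigma> u)"
        using hd2 by (auto simp: M'_def u'_def)
      show "homog tp S2" using prems(4) unfolding SS by simp
    qed (use ne S2 in auto)
    moreover have "cell tp v (\<lambda>x y. I x y \<or> (\<exists>u. M' x u \<and> y = \<sigma> u)) c" if "c \<in> set Rs" for c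
      by (rule cell_mono[OF Rs(3)[rule_format, OF that]]) (auto simp: I'_def M'_def)
    moreover have "symp M'" using M(1) by (auto simp: M'_def symp_def)
    moreover have "right_unique M'"
      using M(2) neM uu' by (auto simp: M'_def right_unique_def)
    moreover have "x \<in> last ` set (butlast SS)" if "M' x y" for x y
    proof -
      have b: "butlast SS = P @ S1 # S2 # (if Q = [] then [] else S3 # butlast Q)"
        unfolding SS by (simp add: butlast_append)
      have "x \<in> last ` set (butlast SS') \<or> x = u \<or> x = u'" using that M(3) by (auto simp: M'_def)
      then show ?thesis unfolding b SS'_def u_def u'_def using ne
        by (auto simp: butlast_append split: if_splits)
    qed
    moreover have "mset (concat (S2 # Rs)) = mset (concat SS)"
      using Rs(1) unfolding SS SS'_def by simp
    moreover have "2 * length (S2 # Rs) = length SS + 1" using Rs(2) len by simp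
    ultimately show ?thesis
      by (intro exI[of _ "S2 # Rs"] exI[of _ M']) auto
  qed
qed

section \<open>Gluing cells along inverse letters\<close>

lemma cell_rotate:
  assumes "cell tp v R (xs @ ys)" "\<forall>x\<in>set (xs @ ys). v x \<in> carrier G"
  shows "cell tp v R (ys @ xs)"
  unfolding cell_def
proof (intro conjI)
  show "cyclically R (ys @ xs)" using assms(1) cyclically_rotate unfolding cell_def by blast
  have "set (map v xs) \<subseteq> carrier G" "set (map v ys) \<subseteq> carrier G" using assms(2) by auto
  then show "mprod G (map v (ys @ xs)) = \<one>"
    using assms(1) mprod_rotate_eq_one[of "map v xs" "map v ys"] unfolding cell_def by simp
  show "homog tp (ys @ xs)" using assms(1) unfolding cell_def homog_def by auto
qed

text \<open>Two disks glued along an edge form a disk. The remainders of the two boundaries have the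
  values \<open>inv (v e)\<close> and \<open>v e\<close>, which cancel.\<close>

lemma cell_merge:
  assumes c1: "cell tp v R (e # xs)" and c2: "cell tp v R (e' # ys)"
    and v: "\<forall>x\<in>set (e # xs @ e' # ys). v x \<in> carrier G"
    and e: "v e' = inv (v e)" "tp e' = tp e"
    and R: "\<And>x y. R x e \<Longrightarrow> R e' y \<Longrightarrow> R x y" "\<And>x y. R x e' \<Longrightarrow> R e y \<Longrightarrow> R x y"
    and ne: "xs @ ys \<noteq> []"
  shows "cell tp v R (xs @ ys)"
  unfolding cell_def
proof (intro conjI)
  have 1: "successively R xs" "xs = [] \<Longrightarrow> R e e" "xs \<noteq> [] \<Longrightarrow> R e (hd xs)" "xs \<noteq> [] \<Longrightarrow> R (last xs) e"
    using c1 unfolding cell_def cyclically_def by (auto simp: successively_Cons split: if_splits)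
  have 2: "successively R ys" "ys = [] \<Longrightarrow> R e' e'" "ys \<noteq> [] \<Longrightarrow> R e' (hd ys)" "ys \<noteq> [] \<Longrightarrow> R (last ys) e'"
    using c2 unfolding cell_def cyclically_def by (auto simp: successively_Cons split: if_splits)
  show "cyclically R (xs @ ys)"
  proof (cases "xs = []")
    case True
    then have "ys \<noteq> []" using ne by simp
    then show ?thesis using True 1(2) 2 R(1)[of "last ys" "hd ys"] R(2)[of "last ys" e]
      by (simp add: cyclically_def)
  next
    case xs: False
    show ?thesis
    proof (cases "ys = []")
      case True
      then show ?thesis using xs 2(2) 1 R(2)[of "last xs" "hd xs"] R(1)[of "last xs" e']
        by (simp add: cyclically_def)
    next
      case False
      then show ?thesis using xs 1 2 R(1)[of "last xs" "hd ys"] R(2)[of "last ys" "hd xs"]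
        by (simp add: cyclically_def successively_append_iff)
    qed
  qed
  have cl: "v e \<in> carrier G" "set (map v xs) \<subseteq> carrier G" "set (map v ys) \<subseteq> carrier G"
    using v by auto
  have "v e \<otimes> mprod G (map v xs) = \<one>" "inv (v e) \<otimes> mprod G (map v ys) = \<one>"
    using c1 c2 e unfolding cell_def by simp_all
  then have "mprod G (map v xs) \<otimes> v e = \<one>" "mprod G (map v ys) \<otimes> inv (v e) = \<one>"
    using cl inv_comm by (meson inv_closed mprod_closed)+
  then have "inv (v e) = mprod G (map v xs)" "inv (inv (v e)) = mprod G (map v ys)"
    using cl by (intro inv_equality; auto intro: mprod_closed)+
  then show "mprod G (map v (xs @ ys)) = \<one>"
    using cl by (simp add: mprod_append flip: \<open>inv (v e) = _\<close> \<open>inv (inv (v e)) = _\<close>)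
  show "homog tp (xs @ ys)"
    using c1 c2 e(2) unfolding cell_def by (auto simp: homog_append homog_Cons)
qed

text \<open>The last two conditions let the successor relation pass across the glued edge in either
  direction, so that it survives a merging of cells.\<close>

definition gluable ::
  "('t \<Rightarrow> bool) \<Rightarrow> ('t \<Rightarrow> 'g) \<Rightarrow> ('t \<Rightarrow> 't \<Rightarrow> bool) \<Rightarrow> ('t \<Rightarrow> nat) \<Rightarrow> 't \<Rightarrow> 't \<Rightarrow> bool" where
  "gluable tp v R wt e e' \<longleftrightarrow> v e' = inv (v e) \<and> tp e' = tp e \<and> wt e = 1 \<and> wt e' = 1 \<and>
    (\<forall>x y. R x e \<longrightarrow> R e' y \<longrightarrow> R x y) \<and> (\<forall>x y. R x e' \<longrightarrow> R e y \<longrightarrow> R x y)"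

text \<open>The bound on the weights keeps every cell nonempty, as an empty one would contribute 2.\<close>

lemma glue_cells:
  assumes "distinct (concat Cs)" "distinct (map fst ps @ map snd ps)"
    and "\<forall>c\<in>set Cs. cell tp v R c"
    and "\<forall>x\<in>set (concat Cs). v x \<in> carrier G"
    and "\<forall>p\<in>set ps. gluable tp v R wt (fst p) (snd p)"
    and "(\<Sum>c\<leftarrow>Cs. 2 - (\<Sum>x\<leftarrow>c. wt x)) \<le> (1::nat)"
  shows "\<exists>Ds. length Cs \<le> length Ds + length ps \<and> distinct (concat Ds) \<and>
    set (concat Ds) \<subseteq> set (concat Cs) - fst ` set ps - snd ` set ps \<and>
    (\<forall>c\<in>set Ds. cell tp v R c)"
  using assms
proof (induction ps arbitrary: Cs)
  case Nil
  then show ?case by (intro exI[of _ Cs]) auto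
next
  case (Cons p ps)
  obtain e e' where p: "p = (e, e')" by force
  have g: "gluable tp v R wt e e'" using Cons.prems(5) p by simp
  have gl: "v e' = inv (v e)" "tp e' = tp e" "wt e = 1" "wt e' = 1"
      "\<And>x y. R x e \<Longrightarrow> R e' y \<Longrightarrow> R x y" "\<And>x y. R x e' \<Longrightarrow> R e y \<Longrightarrow> R x y"
    using g unfolding gluable_def by blast+
  \<comment> \<open>It suffices to get rid of \<open>e\<close> and \<open>e'\<close> at the price of
    one cell.\<close>
  have step: ?case
    if Cs': "length Cs \<le> length Cs' + 1" "distinct (concat Cs')" "\<forall>c\<in>set Cs'. cell tp v R c"
      "set (concat Cs') \<subseteq> set (concat Cs) - {e, e'}"
      "(\<Sum>c\<leftarrow>Cs'. 2 - (\<Sum>x\<leftarrow>c. wt x)) \<le> (1::nat)" for Cs'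
  proof -
    have "\<exists>Ds. length Cs' \<le> length Ds + length ps \<and> distinct (concat Ds) \<and>
      set (concat Ds) \<subseteq> set (concat Cs') - fst ` set ps - snd ` set ps \<and>
      (\<forall>c\<in>set Ds. cell tp v R c)"
    proof (rule Cons.IH)
      show "\<forall>x\<in>set (concat Cs'). v x \<in> carrier G" using Cs'(4) Cons.prems(4) by blast
      show "distinct (map fst ps @ map snd ps)" using Cons.prems(2) by auto
      show "\<forall>p\<in>set ps. gluable tp v R wt (fst p) (snd p)"
        using Cons.prems(5) by simp
    qed (use Cs' in blast)+
    then obtain Ds where Ds: "length Cs' \<le> length Ds + length ps" "distinct (concat Ds)"
      "set (concat Ds) \<subseteq> set (concat Cs') - fst ` set ps - snd ` set ps"
      "\<forall>c\<in>set Ds. cell tp v R c" by blast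
    have "set (concat Ds) \<subseteq> set (concat Cs) - fst ` set (p # ps) - snd ` set (p # ps)"
      using Ds(3) Cs'(4) unfolding p by (simp, blast)
    moreover have "length Cs \<le> length Ds + length (p # ps)" using Ds(1) Cs'(1) by simp
    ultimately show ?thesis using Ds(2,4) by blast
  qed
  show ?case
  proof (cases "e \<in> set (concat Cs)")
    case False
    show ?thesis
    proof (cases "e' \<in> set (concat Cs)")
      case False
      with \<open>e \<notin> set (concat Cs)\<close> show ?thesis using Cons.prems by (intro step[of Cs]) auto
    next
      case True
      then obtain l c r where Cs: "Cs = l @ c # r" "e' \<in> set c" "e' \<notin> set (concat (l @ r))"
        using distinct_concat_split[OF Cons.prems(1)] by metis
      show ?thesis
        using Cons.prems(1,3,6) Cs \<open>e \<notin> set (concat Cs)\<close> by (intro step[of "l @ r"]) auto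
    qed
  next
    case True
    then obtain l c r where Cs: "Cs = l @ c # r" "e \<in> set c" "e \<notin> set (concat (l @ r))"
      using distinct_concat_split[OF Cons.prems(1)] by metis
    show ?thesis
    proof (cases "e' \<in> set (concat (l @ r))")
      \<comment> \<open>The partner \<open>e'\<close> is on no remaining cell or on \<open>c\<close>
        itself. Gluing \<open>c\<close> to itself does not give a disk, so \<open>c\<close> is given
        up.\<close>
      case False
      then show ?thesis
        using Cons.prems(1,3,6) Cs by (intro step[of "l @ r"]) auto
    next
      \<comment> \<open>The letters lie on different cells, which merge into one.\<close>
      case True
      have d: "distinct (concat (l @ r))" using Cons.prems(1) Cs by auto
      obtain l' c' r' where Cs': "l @ r = l' @ c' # r'" "e' \<in> set c'" "e' \<notin> set (concat (l' @ r'))"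
        using distinct_concat_split[OF d True] by metis
      have mem: "c \<in> set Cs" "c' \<in> set Cs"
        using Cs(1) arg_cong[OF Cs'(1), of set] by auto
      obtain c1 c2 where c: "c = c1 @ e # c2" using split_list[OF Cs(2)] by blast
      obtain c3 c4 where c': "c' = c3 @ e' # c4" using split_list[OF Cs'(2)] by blast
      define xs where "xs = c2 @ c1"
      define ys where "ys = c4 @ c3"
      have mc: "mset (concat Cs) = mset c + mset (concat (l @ r))" unfolding Cs(1) by simp
      have mc': "mset (concat (l @ r)) = mset c' + mset (concat (l' @ r'))" unfolding Cs'(1) by simp
      have mm: "mset (concat Cs) = {#e, e'#} + mset (concat ((xs @ ys) # l' @ r'))"
        unfolding mc mc' unfolding c c' xs_def ys_def by simp
      have vv: "\<forall>x\<in>set c \<union> set c'. v x \<in> carrier G" using Cons.prems(4) mem by auto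
      have "cell tp v R (e # xs)" unfolding xs_def
        using cell_rotate[of tp v R c1 "e # c2"] Cons.prems(3) mem(1) vv unfolding c by auto
      moreover have "cell tp v R (e' # ys)" unfolding ys_def
        using cell_rotate[of tp v R c3 "e' # c4"] Cons.prems(3) mem(2) vv unfolding c' by auto
      moreover have "\<forall>x\<in>set (e # xs @ e' # ys). v x \<in> carrier G"
        using vv unfolding c c' xs_def ys_def by auto
      moreover define W where "W c = (\<Sum>x\<leftarrow>c. wt x)" for c
      have W: "W c = 1 + W xs" "W c' = 1 + W ys" "W (xs @ ys) = W xs + W ys"
        unfolding W_def c c' xs_def ys_def using gl by simp_all
      have sums: "(\<Sum>c\<leftarrow>Cs. 2 - W c) = (2 - W c) + (\<Sum>c\<leftarrow>l @ r. 2 - W c)"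
        unfolding Cs(1) by simp
      have sums': "(\<Sum>c\<leftarrow>l @ r. 2 - W c) = (2 - W c') + (\<Sum>c\<leftarrow>l' @ r'. 2 - W c)"
        unfolding Cs'(1) by simp
      have le: "(2 - W c) + (2 - W c') + (\<Sum>c\<leftarrow>l' @ r'. 2 - W c) \<le> 1"
        using Cons.prems(6) sums sums' unfolding W_def by simp
      \<comment> \<open>An empty merged cell would come from two cells of weight 1, whose deficits
        already add up to 2.\<close>
      then have "xs @ ys \<noteq> []"
        using W by (auto simp: W_def)
      ultimately have cell: "cell tp v R (xs @ ys)"
        using gl by (intro cell_merge[of tp v R e xs e' ys])
      have dd: "distinct ([e, e'] @ concat ((xs @ ys) # l' @ r'))"
        using mset_eq_imp_distinct_iff[of "concat Cs" "[e, e'] @ concat ((xs @ ys) # l' @ r')"]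
          mm Cons.prems(1) by simp
      have ss: "set (concat Cs) = {e, e'} \<union> set (concat ((xs @ ys) # l' @ r'))"
        using arg_cong[OF mm, of set_mset] unfolding set_mset_mset by simp
      show ?thesis
      proof (rule step[of "(xs @ ys) # l' @ r'"])
        have "length Cs = length (l @ r) + 1" unfolding Cs(1) by simp
        then show "length Cs \<le> length ((xs @ ys) # l' @ r') + 1"
          unfolding Cs'(1) by simp
        show "distinct (concat ((xs @ ys) # l' @ r'))" using dd by simp
        have "set (l' @ r') \<subseteq> set Cs"
          using arg_cong[OF Cs'(1), of set] unfolding Cs(1) by auto
        then show "\<forall>c\<in>set ((xs @ ys) # l' @ r'). cell tp v R c"
          using Cons.prems(3) cell by auto
        show "set (concat ((xs @ ys) # l' @ r')) \<subseteq> set (concat Cs) - {e, e'}"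
          using dd ss by auto
        have "(2 - W (xs @ ys)) + (\<Sum>c\<leftarrow>l' @ r'. 2 - W c) \<le> 1" using le W by simp
        then show "(\<Sum>c\<leftarrow>(xs @ ys) # l' @ r'. 2 - (\<Sum>x\<leftarrow>c. wt x)) \<le> 1"
          unfolding W_def by simp
      qed
    qed
  qed
qed

end

section \<open>Decomposing a word into sides\<close>

fun switches :: "('t \<Rightarrow> bool) \<Rightarrow> 't list \<Rightarrow> nat" where
  "switches tp (x # y # xs) = (if tp x = tp y then 0 else 1) + switches tp (y # xs)"
| "switches tp _ = 0"

lemma switches_append:
  "xs \<noteq> [] \<Longrightarrow> ys \<noteq> [] \<Longrightarrow>
   switches tp (xs @ ys) = switches tp xs + (if tp (last xs) = tp (hd ys) then 0 else 1) + switches tp ys"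
proof (induction tp xs rule: switches.induct)
  case ("2_2" tp v)
  then show ?case by (cases ys) auto
qed auto

lemma switches_alternating: "successively (\<lambda>x y. tp x \<noteq> tp y) xs \<Longrightarrow> switches tp xs = length xs - 1"
  by (induction tp xs rule: switches.induct) auto

text \<open>Built from the right: a letter of the same type as the next one extends the first block,
  any other letter opens a new block. So there is one block more than there are switches.\<close>

lemma ex_sides:
  assumes "xs \<noteq> []" "successively (\<lambda>x y. if tp x = tp y then I x y else y = \<sigma> x) xs"
  shows "\<exists>SS. concat SS = xs \<and> (\<forall>S\<in>set SS. S \<noteq> []) \<and> (\<forall>S\<in>set SS. homog tp S) \<and>
    successively (\<lambda>S S'. tp (hd S) \<noteq> tp (hd S')) SS \<and> successively (\<lambda>S S'. hd S' = \<sigma> (last S)) SS \<and>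
    (\<forall>S\<in>set SS. successively I S) \<and> length SS = Suc (switches tp xs)"
  using assms
proof (induction tp xs rule: switches.induct)
  case (1 tp x y xs)
  from 1 obtain SS where SS: "concat SS = y # xs" "\<forall>S\<in>set SS. S \<noteq> []" "\<forall>S\<in>set SS. homog tp S"
    "successively (\<lambda>S S'. tp (hd S) \<noteq> tp (hd S')) SS" "successively (\<lambda>S S'. hd S' = \<sigma> (last S)) SS"
    "\<forall>S\<in>set SS. successively I S" "length SS = Suc (switches tp (y # xs))"
    by (auto split: if_splits)
  obtain S T where ST: "SS = S # T" "S \<noteq> []" "hd S = y"
    using SS(1,2) by (cases SS) (auto simp: hd_append, metis hd_append2 list.sel(1))
  show ?case
  proof (cases "tp x = tp y")
    case True
    have "successively (\<lambda>S S'. tp (hd S) \<noteq> tp (hd S')) ((x # S) # T)"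
      using SS(4) ST True by (simp add: successively_Cons)
    moreover have "successively (\<lambda>S S'. hd S' = \<sigma> (last S)) ((x # S) # T)"
      using SS(5) ST by (simp add: successively_Cons)
    moreover have "homog tp (x # S)" using SS(3) ST True by (simp add: homog_Cons)
    moreover have "successively I (x # S)"
      using SS(6) ST True "1.prems"(2) by (simp add: successively_Cons)
    ultimately show ?thesis
      using SS ST True by (intro exI[of _ "(x # S) # T"]) simp
  next
    case False
    have "successively (\<lambda>S S'. tp (hd S) \<noteq> tp (hd S')) ([x] # S # T)"
      using SS(4) ST False by (simp add: successively_Cons)
    moreover have "successively (\<lambda>S S'. hd S' = \<sigma> (last S)) ([x] # S # T)"
      using SS(5) ST False "1.prems"(2) by (simp add: successively_Cons)
    moreover have "homog tp [x]" by (simp add: homog_def)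
    ultimately show ?thesis
      using SS ST False by (intro exI[of _ "[x] # S # T"]) simp
  qed
next
  case ("2_2" tp v)
  then show ?case by (intro exI[of _ "[[v]]"]) (simp add: homog_def)
qed simp

lemma successively_butlast:
  "successively P xs \<Longrightarrow> x \<in> set (butlast xs) \<Longrightarrow> \<exists>y\<in>set xs. P x y"
  by (induction P xs rule: successively.induct) auto

text \<open>The successor relation after gluing: on arriving at a band letter \<open>e\<close>, the
  boundary of the merged cell continues from the partner \<open>mate e\<close>.\<close>

inductive path :: "('t \<Rightarrow> 't) \<Rightarrow> ('t \<Rightarrow> bool) \<Rightarrow> ('t \<Rightarrow> 't \<Rightarrow> bool) \<Rightarrow> 't \<Rightarrow> 't \<Rightarrow> bool"
  for mate :: "'t \<Rightarrow> 't" and Q :: "'t \<Rightarrow> bool" and adj :: "'t \<Rightarrow> 't \<Rightarrow> bool" where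
  base: "adj x y \<Longrightarrow> path mate Q adj x y"
| step: "path mate Q adj x e \<Longrightarrow> Q e \<Longrightarrow> adj (mate e) y \<Longrightarrow> path mate Q adj x y"

lemma path_through:
  "path mate Q adj z y \<Longrightarrow> z = mate e \<Longrightarrow> path mate Q adj x e \<Longrightarrow> Q e \<Longrightarrow> path mate Q adj x y"
  by (induction rule: path.induct) (auto intro: path.intros)

section \<open>Surfaces bounded by a power of a cyclically reduced word\<close>

text \<open>\<^term>\<open>Wt p\<close> is the letter at position \<^term>\<open>p\<close> of the power of the word, and
  \<^term>\<open>Bt i s r\<close> the \<^term>\<open>r\<close>th letter of the \<^term>\<open>i\<close>th gluing word
  or, for \<^term>\<open>s = False\<close>, of its inverse.\<close>

datatype tok = Wt nat | Bt nat bool nat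

text \<open>\<open>c\<close> is one period of the word and \<epsilon> plays the role of
  \<open>1/N\<close>. \<open>zs\<close> is the order in which the gluing words and their inverses
  follow the power on the boundary of the disk. Odd length makes every gluing word begin and end in
  \<open>H True\<close>; only its end letters may be trivial.\<close>

locale surface_data = free_factors G H for G :: "('g, 'm) monoid_scheme" (structure) and H +
  fixes c :: "nat \<Rightarrow> 'g" and L n m :: nat and xw :: "nat \<Rightarrow> 'g list" and zs :: "(nat \<times> bool) list"
    and \<epsilon> :: real
  assumes pos: "L > 0" "n > 0" "m > 0"
    and c: "p < 2 * L \<Longrightarrow> c p \<in> H (even p)"
    and xw: "odd (length (xw i))" "r < length (xw i) \<Longrightarrow> xw i ! r \<in> H (even r)"
      "0 < r \<Longrightarrow> Suc r < length (xw i) \<Longrightarrow> xw i ! r \<noteq> \<one>"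
    and zs: "distinct zs" "set zs = {..<m} \<times> UNIV"
    and one: "mprod G (map (\<lambda>p. c (p mod (2 * L))) [0..<2 * L * n]) \<otimes>
      mprod G (map (\<lambda>(i, s). if s then mprod G (xw i) else inv (mprod G (xw i))) zs) = \<one>"
    and eps: "0 \<le> \<epsilon>" "\<epsilon> \<le> 1 / 2"
      "p < 2 * L \<Longrightarrow> 0 < r \<Longrightarrow> c p [^] (r::nat) = \<one> \<Longrightarrow> 1 \<le> real r * \<epsilon>"
begin

definition "K = 2 * L * n"
abbreviation "len i \<equiv> length (xw i)"

fun val :: "tok \<Rightarrow> 'g" where
  "val (Wt p) = c (p mod (2 * L))"
| "val (Bt i s r) = (if s then xw i ! r else inv (xw i ! (len i - 1 - r)))"

fun tp :: "tok \<Rightarrow> bool" where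
  "tp (Wt p) = even p"
| "tp (Bt i s r) = even r"

text \<open>After the last letter of a gluing word, \<open>Wt 0\<close> is a mere default: both
  letters have type \<open>True\<close>, so it is never taken for a switch.\<close>

fun sig :: "tok \<Rightarrow> tok" where
  "sig (Wt p) = (if Suc p < K then Wt (Suc p) else Bt (fst (hd zs)) (snd (hd zs)) 0)"
| "sig (Bt i s r) = (if Suc r < len i then Bt i s (Suc r) else Wt 0)"

text \<open>The order \<open>zs\<close> is forgotten: any end of a gluing word may be followed by
  any start, since all of them lie at the base vertex. Excluding \<open>x = y\<close> prevents a
  one-letter gluing word from following itself.\<close>

definition junction :: "tok \<Rightarrow> tok \<Rightarrow> bool" where
  "junction x y \<longleftrightarrow> x \<noteq> y \<and> (\<exists>i s. x = Bt i s (len i - 1)) \<and> (y = Wt 0 \<or> (\<exists>i s. y = Bt i s 0))"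

fun mate :: "tok \<Rightarrow> tok" where
  "mate (Wt p) = Wt p"
| "mate (Bt i s r) = Bt i (\<not> s) (len i - 1 - r)"

fun band :: "tok \<Rightarrow> bool" where
  "band (Wt p) = False"
| "band (Bt i s r) = (i < m \<and> r < len i)"

text \<open>The letters with a switching point right after them.\<close>

fun crossing :: "tok \<Rightarrow> bool" where
  "crossing (Wt p) = (p < K)"
| "crossing (Bt i s r) = (Suc r < len i)"

definition word :: "nat \<times> bool \<Rightarrow> tok list" where
  "word z = map (Bt (fst z) (snd z)) [0..<len (fst z)]"

definition "W = map Wt [0..<K] @ concat (map word zs)"

abbreviation "flow \<equiv> \<lambda>x y. if tp x = tp y then junction x y else y = sig x"

lemma K_pos: "K > 0" and even_K: "even K"
  using pos by (simp_all add: K_def)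

lemma len_pos: "len i > 0"
  using xw(1)[of i] by (cases "len i") auto

lemma hd_word: "hd (word z) = Bt (fst z) (snd z) 0"
  and last_word: "last (word z) = Bt (fst z) (snd z) (len (fst z) - 1)"
  and word_ne: "word z \<noteq> []"
  using len_pos[of "fst z"] by (simp_all add: word_def hd_map last_map)

lemma flow_word: "successively flow (word z)" "switches tp (word z) = len (fst z) - 1"
proof -
  have "successively (\<lambda>x y. tp x \<noteq> tp y \<and> y = sig x) (word z)"
    by (auto simp: successively_iff_nth word_def)
  note alt = this
  show "successively flow (word z)"
    by (rule successively_mono[OF alt]) simp
  have "successively (\<lambda>x y. tp x \<noteq> tp y) (word z)"
    by (rule successively_mono[OF alt]) simp
  from switches_alternating[OF this] show "switches tp (word z) = len (fst z) - 1"
    by (simp add: word_def)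
qed

text \<open>Gluing words meet in letters of the same factor, so no switch occurs between them.
  Distinctness ensures that the two letters at a junction differ.\<close>

lemma flow_words:
  "zz \<noteq> [] \<Longrightarrow> distinct zz \<Longrightarrow> successively flow (concat (map word zz)) \<and>
    hd (concat (map word zz)) = Bt (fst (hd zz)) (snd (hd zz)) 0 \<and>
    last (concat (map word zz)) = Bt (fst (last zz)) (snd (last zz)) (len (fst (last zz)) - 1) \<and>
    concat (map word zz) \<noteq> [] \<and>
    switches tp (concat (map word zz)) = (\<Sum>z\<leftarrow>zz. len (fst z) - 1)"
proof (induction zz)
  case (Cons z zz)
  show ?case
  proof (cases "zz = []")
    case True
    then show ?thesis using flow_word[of z] hd_word last_word word_ne by simp
  next
    case False
    let ?w = "concat (map word zz)"
    have IH: "successively flow ?w" "hd ?w = Bt (fst (hd zz)) (snd (hd zz)) 0" "?w \<noteq> []"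
      "last ?w = Bt (fst (last zz)) (snd (last zz)) (len (fst (last zz)) - 1)"
      "switches tp ?w = (\<Sum>z\<leftarrow>zz. len (fst z) - 1)"
      using Cons False by auto
    have "z \<noteq> hd zz" using Cons.prems False by auto
    then have j: "junction (last (word z)) (hd ?w)"
      unfolding last_word IH(2) junction_def by (auto simp: prod_eq_iff)
    have t: "tp (last (word z)) = tp (hd ?w)"
      unfolding last_word IH(2) using xw(1) by simp
    have "concat (map word (z # zz)) = word z @ ?w" by simp
    moreover have "successively flow (word z @ ?w)"
      unfolding successively_append_iff using flow_word IH j t by simp
    moreover have "switches tp (word z @ ?w) = (\<Sum>z\<leftarrow>z # zz. len (fst z) - 1)"
      using switches_append[OF word_ne IH(3)] flow_word t IH(5) by simp
    ultimately show ?thesis using IH hd_word word_ne False by simp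
  qed
qed simp

lemma zs_ne: "zs \<noteq> []"
proof -
  have "(0, True) \<in> set zs" unfolding zs(2) using pos(3) by simp
  then show ?thesis by auto
qed

lemma W_props:
  "successively flow W" "W \<noteq> []" "hd W = Wt 0" "junction (last W) (hd W)"
  "switches tp W = K + 2 * (\<Sum>i<m. len i - 1)"
proof -
  let ?u = "map Wt [0..<K]" and ?w = "concat (map word zs)"
  have w: "successively flow ?w" "hd ?w = Bt (fst (hd zs)) (snd (hd zs)) 0" "?w \<noteq> []"
      "last ?w = Bt (fst (last zs)) (snd (last zs)) (len (fst (last zs)) - 1)"
      "switches tp ?w = (\<Sum>z\<leftarrow>zs. len (fst z) - 1)"
    using flow_words[OF zs_ne zs(1)] by auto
  have u1: "successively (\<lambda>x y. tp x \<noteq> tp y \<and> y = sig x) ?u"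
    by (auto simp: successively_iff_nth)
  have "successively (\<lambda>x y. tp x \<noteq> tp y) ?u"
    by (rule successively_mono[OF u1]) simp
  from switches_alternating[OF this] have u: "successively flow ?u" "switches tp ?u = K - 1"
    by (auto intro: successively_mono[OF u1])
  have lu: "last ?u = Wt (K - 1)" "?u \<noteq> []" "hd ?u = Wt 0"
    using K_pos by (simp_all add: last_map hd_map)
  \<comment> \<open>The power ends in \<open>H False\<close> and the gluing words begin in
    \<open>H True\<close>: one more switch beyond the \<open>K - 1\<close> inside the power.\<close>
  have tu: "tp (last ?u) \<noteq> tp (hd ?w)" "hd ?w = sig (last ?u)"
    unfolding lu w(2) using K_pos even_K by auto
  show "successively flow W" unfolding W_def successively_append_iff using u w tu by simp
  show "W \<noteq> []" "hd W = Wt 0" using lu by (simp_all add: W_def)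
  then show "junction (last W) (hd W)"
    using w(3,4) unfolding junction_def W_def by auto
  have "(\<Sum>z\<leftarrow>zs. len (fst z) - 1) = (\<Sum>z\<in>set zs. len (fst z) - 1)"
    using zs(1) by (rule sum_list_distinct_conv_sum_set)
  also have "\<dots> = (\<Sum>i<m. \<Sum>s\<in>(UNIV::bool set). len i - 1)"
    unfolding zs(2) sum.cartesian_product by (simp add: case_prod_unfold)
  also have "\<dots> = 2 * (\<Sum>i<m. len i - 1)"
    by (simp add: sum_distrib_left UNIV_bool mult_2)
  finally show "switches tp W = K + 2 * (\<Sum>i<m. len i - 1)"
    unfolding W_def switches_append[OF lu(2) w(3)] using u tu w(5) K_pos by simp
qed

lemma set_W: "set W = Wt ` {..<K} \<union> {x. band x}"
proof -
  have "x \<in> set (concat (map word zs)) \<longleftrightarrow> band x" for x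
    by (cases x) (force simp: word_def zs(2))+
  then show ?thesis unfolding W_def by auto
qed

lemma distinct_W: "distinct W"
proof -
  have "distinct (concat (map word zz))" if "distinct zz" for zz
    using that
  proof (induction zz)
    case (Cons z zz)
    have "z' = z" if "x \<in> set (word z)" "x \<in> set (word z')" for x z'
      using that by (auto simp: word_def prod_eq_iff)
    then have "set (word z) \<inter> set (concat (map word zz)) = {}"
      using Cons.prems by auto
    moreover have "distinct (word z)" by (auto simp: word_def distinct_map inj_on_def)
    ultimately show ?case using Cons by simp
  qed simp
  moreover have "set (map Wt [0..<K]) \<inter> set (concat (map word zs)) = {}"
    by (auto simp: word_def)
  ultimately show ?thesis using zs(1) by (auto simp: W_def distinct_map inj_on_def)
qed

lemma val_H: "x \<in> set W \<Longrightarrow> val x \<in> H (tp x)"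
proof (cases x)
  case (Wt p)
  have "p mod (2 * L) < 2 * L" using pos by simp
  then show ?thesis using c[of "p mod (2 * L)"] Wt by (simp add: dvd_mod_iff)
next
  case (Bt i s r)
  assume "x \<in> set W"
  then have r: "r < len i" using Bt by (auto simp: set_W)
  \<comment> \<open>Reversing a word of odd length preserves the parity of positions.\<close>
  moreover have "even (len i - 1 - r) = even r" using xw(1)[of i] r by simp
  ultimately show ?thesis
    using xw(2)[of r i] xw(2)[of "len i - 1 - r" i] subgroup.m_inv_closed[OF sub] Bt by auto
qed

lemma xw_carrier: "set (xw i) \<subseteq> carrier G"
proof
  fix x assume "x \<in> set (xw i)"
  then obtain r where "r < len i" "x = xw i ! r" by (auto simp: in_set_conv_nth)
  then show "x \<in> carrier G" using xw(2)[of r i] H_carrier by blast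
qed

lemma mprod_word:
  "mprod G (map val (word (i, s))) = (if s then mprod G (xw i) else inv (mprod G (xw i)))"
proof (cases s)
  case True
  then have "map val (word (i, s)) = xw i" by (auto simp: word_def intro: nth_equalityI)
  then show ?thesis using True by simp
next
  case False
  then have "map val (word (i, s)) = rev (map (\<lambda>x. inv x) (xw i))"
    by (auto simp: word_def rev_nth intro!: nth_equalityI)
  then show ?thesis using False mprod_inv[OF xw_carrier] by simp
qed

lemma mprod_W: "mprod G (map val W) = \<one>"
proof -
  have car: "val x \<in> carrier G" if "x \<in> set W" for x using val_H[OF that] H_carrier by blast
  have "mprod G (map val W) = mprod G (map val (map Wt [0..<K])) \<otimes> mprod G (map val (concat (map word zs)))"
    unfolding W_def map_append using car by (intro mprod_append) (auto simp: W_def simp del: val.simps)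
  moreover have "mprod G (map val (concat (map word zs))) = mprod G (map (mprod G) (map (map val) (map word zs)))"
  proof -
    have "set xs \<subseteq> carrier G" if xs: "xs \<in> set (map (map val) (map word zs))" for xs
    proof -
      obtain z where "z \<in> set zs" "xs = map val (word z)" using xs by auto
      then show ?thesis using car by (auto simp: W_def simp del: val.simps)
    qed
    then show ?thesis unfolding map_concat by (rule mprod_concat)
  qed
  moreover have "map (mprod G) (map (map val) (map word zs)) =
      map (\<lambda>(i, s). if s then mprod G (xw i) else inv (mprod G (xw i))) zs"
    using mprod_word by (auto simp del: val.simps)
  moreover have "map val (map Wt [0..<K]) = map (\<lambda>p. c (p mod (2 * L))) [0..<2 * L * n]"
    by (simp add: K_def comp_def)
  ultimately show ?thesis using one by (simp only:)
qed

lemma crossing_switch: "x \<in> set W \<Longrightarrow> tp (sig x) \<noteq> tp x \<Longrightarrow> crossing x"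
  using xw(1) by (cases x) (auto simp: set_W split: if_splits, (metis Suc_lessI diff_Suc_1 odd_Suc_div_two even_Suc)+)

text \<open>There is one side more than switches, and the cells number half of the sides plus one:
  half the number of switches, plus 1.\<close>

lemma ex_cells:
  "\<exists>Rs M. mset (concat Rs) = mset W \<and> length Rs = 1 + L * n + (\<Sum>i<m. len i - 1) \<and>
    (\<forall>c\<in>set Rs. cell tp val (\<lambda>x y. junction x y \<or> (\<exists>u. M x u \<and> y = sig u)) c) \<and>
    symp M \<and> right_unique M \<and> (\<forall>x u. M x u \<longrightarrow> crossing x)"
proof -
  obtain SS where SS: "concat SS = W" "\<forall>S\<in>set SS. S \<noteq> []" "\<forall>S\<in>set SS. homog tp S"
    "successively (\<lambda>S S'. tp (hd S) \<noteq> tp (hd S')) SS" "successively (\<lambda>S S'. hd S' = sig (last S)) SS"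
    "\<forall>S\<in>set SS. successively junction S" "length SS = Suc (switches tp W)"
    using ex_sides[OF W_props(2,1)] by auto
  have ne: "SS \<noteq> []" using SS(7) by auto
  have "hd (hd SS) = hd W" "last (last SS) = last W"
    unfolding SS(1)[symmetric] using ne SS(2)
    by (cases SS, auto, cases SS rule: rev_cases, auto)
  then have j: "junction (last (last SS)) (hd (hd SS))" using W_props(4) by simp
  have "odd (length SS)" using SS(7) W_props(5) even_K by simp
  then obtain Rs M where R: "mset (concat Rs) = mset (concat SS)" "2 * length Rs = length SS + 1"
    "\<forall>c\<in>set Rs. cell tp val (\<lambda>x y. junction x y \<or> (\<exists>u. M x u \<and> y = sig u)) c"
    "symp M" "right_unique M" "\<forall>x u. M x u \<longrightarrow> x \<in> last ` set (butlast SS)"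
    using planar_cells[of SS tp sig junction val] SS j distinct_W val_H mprod_W by auto
  have "crossing x" if xu: "M x u" for x u
  proof -
    obtain S where S: "S \<in> set (butlast SS)" "x = last S" using R(6) xu by blast
    have "successively (\<lambda>S S'. tp (hd S) \<noteq> tp (hd S') \<and> hd S' = sig (last S)) SS"
      using SS(4,5) by (simp add: successively_iff_nth)
    then obtain S' where S': "tp (hd S) \<noteq> tp (hd S')" "hd S' = sig (last S)"
      using successively_butlast[OF _ S(1)] by blast
    have "S \<in> set SS" using S(1) by (rule in_set_butlastD)
    moreover from this have "S \<noteq> []" "homog tp S" using SS(2,3) by auto
    moreover from this have "tp x = tp (hd S)" using S(2) homog_hd[of tp S x] by simp
    moreover have "x \<in> set W"
      unfolding SS(1)[symmetric] using S(2) \<open>S \<in> set SS\<close> last_in_set[OF \<open>S \<noteq> []\<close>] by auto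
    ultimately show ?thesis using S' S(2) crossing_switch by simp
  qed
  moreover have "length Rs = 1 + L * n + (\<Sum>i<m. len i - 1)"
    using R(2) SS(7) W_props(5) unfolding K_def by linarith
  ultimately show ?thesis using R SS(1) by auto
qed

end

section \<open>Turns and arcs of the glued surface\<close>

locale chord_matching = surface_data G H c L n m xw zs \<epsilon>
  for G :: "('g, 'm) monoid_scheme" (structure) and H c L n m xw zs \<epsilon> +
  fixes M :: "tok \<Rightarrow> tok \<Rightarrow> bool"
  assumes M_sym: "M x y \<Longrightarrow> M y x" and M_unique: "M x y \<Longrightarrow> M x z \<Longrightarrow> y = z"
    and M_crossing: "M x y \<Longrightarrow> crossing x"
begin

text \<open>The successor relation before gluing: across a junction, or along a chord to the letter
  after its other end.\<close>

definition adj :: "tok \<Rightarrow> tok \<Rightarrow> bool" where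
  "adj x y \<longleftrightarrow> junction x y \<or> (\<exists>u. M x u \<and> y = sig u)"

abbreviation "turn \<equiv> path mate band adj"

text \<open>\<^term>\<open>kap u\<close> is the switching point glued to \<^term>\<open>u\<close>; a chord continues through the
  bands until it meets the boundary again.\<close>

fun kap :: "tok \<Rightarrow> tok" where
  "kap (Bt i s r) = Bt i (\<not> s) (len i - 2 - r)"
| "kap (Wt p) = Wt p"

fun bdry :: "tok \<Rightarrow> bool" where
  "bdry (Wt p) = True"
| "bdry (Bt i s r) = False"

text \<open>Intermediate switching points count as well; the arc is complete once
  \<open>bdry u\<close> holds.\<close>

inductive arc :: "tok \<Rightarrow> tok \<Rightarrow> bool" where
  base: "M x u \<Longrightarrow> arc x u"
| step: "arc x u \<Longrightarrow> \<not> bdry u \<Longrightarrow> M (kap u) w \<Longrightarrow> arc x w"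

lemma arc_crossing: "arc x u \<Longrightarrow> crossing u"
  by (induction rule: arc.induct) (auto dest: M_sym M_crossing)

lemma arc_front: "arc y u \<Longrightarrow> y = kap v \<Longrightarrow> M x v \<Longrightarrow> \<not> bdry v \<Longrightarrow> arc x u"
  by (induction rule: arc.induct) (auto intro: arc.intros)

lemma kap_kap: "crossing u \<Longrightarrow> kap (kap u) = u"
  by (cases u) auto

lemma bdry_kap [simp]: "bdry (kap u) = bdry u"
  by (cases u) auto

lemma arc_sym: "arc x u \<Longrightarrow> arc u x"
proof (induction rule: arc.induct)
  case (base x u)
  then show ?case by (auto intro: arc.base M_sym)
next
  case (step x u w)
  then have "crossing u" by (simp add: arc_crossing)
  then show ?case
    using arc_front[OF step.IH, of "kap u" w] step.hyps(2,3) M_sym by (simp add: kap_kap)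
qed

lemma arc_first: "arc x w \<Longrightarrow> \<exists>v. M x v \<and> (v = w \<or> \<not> bdry v \<and> arc (kap v) w)"
  by (induction rule: arc.induct) (auto intro: arc.intros)

text \<open>Matching and gluing are both involutive, so an arc that has reached \<open>x\<close> can
  only be retraced from there to its origin.\<close>

lemma arc_backwards_unique: "arc w x \<Longrightarrow> bdry w \<Longrightarrow> arc x u \<Longrightarrow> bdry u \<Longrightarrow> u = w"
proof (induction rule: arc.induct)
  case (base w x)
  obtain v where v: "M x v" "v = u \<or> \<not> bdry v \<and> arc (kap v) u"
    using arc_first base.prems by blast
  then have "v = w" using M_unique M_sym base.hyps by blast
  then show ?case using v base.prems by auto
next
  case (step w x' x)
  obtain v where v: "M x v" "v = u \<or> \<not> bdry v \<and> arc (kap v) u"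
    using arc_first step.prems by blast
  then have vk: "v = kap x'" using M_unique M_sym step.hyps by blast
  then have "\<not> bdry v" using step.hyps by simp
  then have "arc x' u" using v vk kap_kap[of x'] arc_crossing step by auto
  then show ?case using step by blast
qed

lemma arc_unique: "arc x u \<Longrightarrow> arc x w \<Longrightarrow> bdry u \<Longrightarrow> bdry w \<Longrightarrow> u = w"
  using arc_backwards_unique arc_sym by blast

definition nx :: "nat \<Rightarrow> nat" where
  "nx z = (if Suc z < K then Suc z else 0)"

text \<open>A turn follows one bank of an arc through the bands and emerges at the letter after its
  far end. Only if the arc ends at \<open>Wt (K - 1)\<close> may it go on, through bands around the
  base vertex towards \<open>Wt 0\<close>.\<close>

lemma turn_arc:
  assumes "turn x y" "x = Wt p"
  shows "\<exists>u. arc x u \<and> (y = sig u \<or> (u = Wt (K - 1) \<and> (y = Wt 0 \<or> (\<exists>i s. y = Bt i s 0))))"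
  using assms
proof (induction rule: path.induct)
  case (base x y)
  then show ?case by (auto simp: adj_def junction_def intro: arc.base)
next
  case (step x e y)
  then obtain u where u: "arc x u" "e = sig u \<or> (u = Wt (K - 1) \<and> (e = Wt 0 \<or> (\<exists>i s. e = Bt i s 0)))"
    by blast
  have cu: "crossing u" using u(1) by (rule arc_crossing)
  show ?case
  proof (cases "\<exists>i s r. u = Bt i s r")
    case True
    then obtain i s r where ub: "u = Bt i s r" by blast
    then have r: "Suc r < len i" and e: "e = Bt i s (Suc r)" using cu u(2) by auto
    \<comment> \<open>The letter after \<open>u\<close> is glued to the letter just before the
      switching point \<open>kap u\<close>.\<close>
    have mk: "mate e = kap u" unfolding e ub by simp
    have "\<not> junction (mate e) y"
      unfolding e junction_def using r by auto
    then obtain w where "M (kap u) w" "y = sig w"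
      using step.hyps(3) unfolding adj_def mk by blast
    moreover from this have "arc x w" using u(1) ub arc.step by simp
    ultimately show ?thesis by blast
  next
    case False
    then obtain q where uq: "u = Wt q" by (cases u) auto
    have "u = Wt (K - 1) \<and> (\<exists>i s. e = Bt i s 0)"
      using u(2) cu step.hyps(2) unfolding uq by (auto split: if_splits)
    then obtain i s where e: "e = Bt i s 0" and uK: "u = Wt (K - 1)" by blast
    \<comment> \<open>The partner of a first letter is a last letter, where no chord ends; only a
      junction can follow.\<close>
    have "\<not> M (mate e) w" for w
      using M_crossing[of "mate e" w] len_pos[of i] unfolding e by auto
    then have "junction (mate e) y" using step.hyps(3) unfolding adj_def by blast
    then show ?thesis using u(1) uK unfolding junction_def by blast
  qed
qed

lemma turn_arc_Wt:
  assumes "turn (Wt p) (Wt q)"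
  shows "\<exists>z<K. arc (Wt p) (Wt z) \<and> q = nx z"
proof -
  obtain u where u: "arc (Wt p) u"
      "Wt q = sig u \<or> (u = Wt (K - 1) \<and> (Wt q = Wt 0 \<or> (\<exists>i s. Wt q = Bt i s 0)))"
    using turn_arc[OF assms] by blast
  have cu: "crossing u" using u(1) by (rule arc_crossing)
  have "(\<exists>z<K. u = Wt z \<and> q = nx z)"
  proof (cases u)
    case (Wt z)
    show ?thesis
    proof (cases "Suc z < K")
      case True
      then have "q = Suc z" using u(2) Wt by auto
      then show ?thesis using Wt True by (simp add: nx_def)
    next
      case False
      then have "q = 0" "z < K" using u(2) Wt cu by (auto split: if_splits)
      then show ?thesis using Wt False by (simp add: nx_def)
    qed
  qed (use u cu in \<open>auto split: if_splits\<close>)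
  then show ?thesis using u(1) by blast
qed

definition other :: "nat \<Rightarrow> nat" where
  "other p = (THE z. arc (Wt p) (Wt z))"

lemma other_eq: "arc (Wt p) (Wt z) \<Longrightarrow> other p = z"
  unfolding other_def using arc_unique[of "Wt p" _ "Wt z"] by (intro the_equality) force+

text \<open>The phase, that is, the position within one period.\<close>

definition ph :: "nat \<Rightarrow> nat" where "ph p = p mod (2 * L)"

text \<open>The cost of the turn from \<open>p\<close> to \<open>nx z\<close>, written in terms of
  the far end \<open>z\<close> of the arc to make both banks comparable. If
  \<open>ph z = 2 * L - 1\<close>, the phase of \<open>nx z\<close> falls back to 0 and the turn is
  no ascent.\<close>

definition cost :: "nat \<Rightarrow> nat \<Rightarrow> real" where
  "cost p z = (if ph p < ph z \<and> ph z \<noteq> 2 * L - 1 then 1 - \<epsilon> else \<epsilon>)"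

text \<open>With weight 2 for boundary letters, only a cell made of a single band letter has a
  deficit.\<close>

definition wt :: "tok \<Rightarrow> nat" where "wt x = (if bdry x then 2 else 1)"

definition pairs :: "(tok \<times> tok) list" where
  "pairs = concat (map (\<lambda>i. map (\<lambda>r. (Bt i True r, Bt i False (len i - 1 - r))) [0..<len i]) [0..<m])"

lemma pairs_props:
  "distinct (map fst pairs @ map snd pairs)" "length pairs = (\<Sum>i<m. len i)"
  "fst ` set pairs \<union> snd ` set pairs = {x. band x}"
proof -
  have "distinct (concat (map (\<lambda>i. map (\<lambda>r. Bt i s (f i r)) [0..<len i]) [0..<k]))"
    if f: "\<And>i. inj_on (f i) {..<len i}" for s f k
  proof (induction k)
    case (Suc k)
    have "distinct (map (\<lambda>r. Bt k s (f k r)) [0..<len k])"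
      using f[of k] unfolding distinct_map by (auto simp: inj_on_def atLeast0LessThan)
    moreover have "set (concat (map (\<lambda>i. map (\<lambda>r. Bt i s (f i r)) [0..<len i]) [0..<k])) \<inter>
        set (map (\<lambda>r. Bt k s (f k r)) [0..<len k]) = {}"
      by auto
    ultimately show ?case using Suc by simp
  qed simp
  note dist = this
  have "inj_on (\<lambda>r. len i - 1 - r) {..<len i}" for i by (rule inj_onI) auto
  then have "distinct (map fst pairs)" "distinct (map snd pairs)"
    using dist[of "\<lambda>_ r. r" True m] dist[of "\<lambda>i r. len i - 1 - r" False m]
    by (simp_all add: pairs_def map_concat comp_def)
  moreover have "set (map fst pairs) \<inter> set (map snd pairs) = {}" by (auto simp: pairs_def)
  ultimately show "distinct (map fst pairs @ map snd pairs)" by simp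
  show "length pairs = (\<Sum>i<m. len i)"
    by (simp add: pairs_def length_concat comp_def sum_list_sum_nth atLeast0LessThan)
  show "fst ` set pairs \<union> snd ` set pairs = {x. band x}" (is "?l = ?r")
  proof
    show "?l \<subseteq> ?r" by (auto simp: pairs_def)
    show "?r \<subseteq> ?l"
    proof
      fix x assume "x \<in> ?r"
      then obtain i s r where x: "x = Bt i s r" "i < m" "r < len i" by (cases x) auto
      have "(Bt i True r, Bt i False (len i - 1 - r)) \<in> set pairs"
        using x by (auto simp: pairs_def intro!: bexI[of _ i])
      moreover have "(Bt i True (len i - 1 - r), Bt i False r) \<in> set pairs"
        using x by (auto simp: pairs_def intro!: bexI[of _ i] image_eqI[of _ _ "len i - 1 - r"])
      ultimately show "x \<in> ?l" using x(1) by (cases s) force+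
    qed
  qed
qed

lemma gluable_pairs: "p \<in> set pairs \<Longrightarrow> gluable tp val turn wt (fst p) (snd p)"
proof -
  assume "p \<in> set pairs"
  then obtain i r where p: "fst p = Bt i True r" "snd p = Bt i False (len i - 1 - r)" and ir: "i < m" "r < len i"
    by (auto simp: pairs_def)
  have m: "mate (fst p) = snd p" "mate (snd p) = fst p" "band (fst p)" "band (snd p)"
    unfolding p using ir by auto
  have "val (snd p) = inv (val (fst p))" "tp (snd p) = tp (fst p)" "wt (fst p) = 1" "wt (snd p) = 1"
    unfolding p wt_def using xw(1)[of i] ir by simp_all
  moreover have "turn x y" if "turn x (fst p)" "turn (snd p) y" for x y
    using path_through[OF that(2) m(1)[symmetric] that(1) m(3)] .
  moreover have "turn x y" if "turn x (snd p)" "turn (fst p) y" for x y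
    using path_through[OF that(2) m(2)[symmetric] that(1) m(4)] .
  ultimately show ?thesis unfolding gluable_def by blast
qed

text \<open>A cell consisting of a single band letter has trivial value, so that letter is an end letter
  of a gluing word, preceded by a switch: there is only one such letter.\<close>

lemma cells_weight:
  assumes Rs: "mset (concat Rs) = mset W" and cells: "\<forall>c\<in>set Rs. cell tp val adj c"
  shows "(\<Sum>c\<leftarrow>Rs. 2 - (\<Sum>x\<leftarrow>c. wt x)) \<le> 1"
proof -
  define sp where "sp = Bt (fst (hd zs)) (snd (hd zs)) 0"
  have "2 - (\<Sum>x\<leftarrow>c. wt x) \<le> length (filter ((=) sp) c)" if c: "c \<in> set Rs" for c
  proof -
    have ne: "c \<noteq> []" using cells c by (auto simp: cell_def cyclically_def)
    have ge: "length c \<le> (\<Sum>x\<leftarrow>c. wt x)" for c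
      by (induction c) (auto simp: wt_def)
    show ?thesis
    proof (cases "length c = 1")
      case False
      then show ?thesis using ge[of c] ne by (cases c; cases "tl c") auto
    next
      case True
      then obtain x where x: "c = [x]" by (cases c) auto
      have cl: "adj x x" "val x = \<one>"
      proof -
        have cx: "cell tp val adj [x]" using cells c x by blast
        then show "adj x x" by (simp add: cell_def cyclically_def)
        have "x \<in> set (concat Rs)" using c x by (auto intro!: bexI[of _ "[x]"])
        then have "x \<in> set W" using Rs by (metis set_mset_mset)
        then have "val x \<in> carrier G" using val_H H_carrier by blast
        then show "val x = \<one>" using cx by (simp add: cell_def)
      qed
      show ?thesis
      proof (cases x)
        case (Wt p)
        then show ?thesis using x by (simp add: wt_def)
      next
        case (Bt i s r)
        \<comment> \<open>A junction never relates a letter to itself, so \<open>x\<close> follows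
          itself along a chord.\<close>
        obtain u where u: "M x u" "x = sig u" using cl(1) by (auto simp: adj_def junction_def)
        have xc: "Suc r < len i" using M_crossing[OF u(1)] Bt by simp
        have uc: "crossing u" using M_crossing M_sym u(1) by blast
        have "x = sp"
        proof (cases u)
          case (Wt q)
          then show ?thesis using u(2) Bt uc by (auto simp: sp_def split: if_splits)
        next
          case (Bt i' s' r')
          \<comment> \<open>A switch inside a gluing word does not lead to a first letter, and
            \<open>x\<close> is not a last letter since a chord leaves it. Interior letters are
            nontrivial.\<close>
          then have "0 < r" using u(2) \<open>x = Bt i s r\<close> uc by auto
          have "xw i ! r \<noteq> \<one>" using xw(3)[of r i] xc \<open>0 < r\<close> by simp
          moreover have "xw i ! (len i - 1 - r) \<noteq> \<one>"
            using xw(3)[of "len i - 1 - r" i] xc \<open>0 < r\<close> by simp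
          moreover have "xw i ! (len i - 1 - r) \<in> carrier G"
            using xw_carrier[of i] nth_mem[of "len i - 1 - r" "xw i"] xc by auto
          ultimately show ?thesis using cl(2) \<open>x = Bt i s r\<close> by (auto split: if_splits)
        qed
        then show ?thesis using x by (simp add: wt_def)
      qed
    qed
  qed
  then have "(\<Sum>c\<leftarrow>Rs. 2 - (\<Sum>x\<leftarrow>c. wt x)) \<le> (\<Sum>c\<leftarrow>Rs. length (filter ((=) sp) c))"
    by (intro sum_list_mono)
  also have "\<dots> = length (filter ((=) sp) (concat Rs))"
    by (simp add: filter_concat length_concat comp_def)
  also have "\<dots> = count (mset (concat Rs)) sp" by (metis count_mset count_list_eq_length_filter)
  also have "\<dots> \<le> 1" using distinct_W unfolding Rs by (metis distinct_count_atmost_1 le_numeral_extra(4) zero_le_one)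
  finally show ?thesis .
qed

end

section \<open>The cost of a cycle\<close>

lemma cyclically_next: "cyclically R c \<Longrightarrow> x \<in> set c \<Longrightarrow> \<exists>y\<in>set c. R x y"
proof -
  assume R: "cyclically R c" and x: "x \<in> set c"
  obtain i where i: "i < length c" "x = c ! i" using x by (auto simp: in_set_conv_nth)
  show ?thesis
  proof (cases "Suc i < length c")
    case True
    then have "R x (c ! Suc i)" using R i unfolding cyclically_def successively_iff_nth by blast
    then show ?thesis using True by (intro bexI[of _ "c ! Suc i"]) auto
  next
    case False
    then have "x = last c" using i by (cases c) (auto simp: last_conv_nth less_Suc_eq)
    then show ?thesis using R by (intro bexI[of _ "hd c"]) (auto simp: cyclically_def)
  qed
qed

lemma cyclically_map: "cyclically R (map f c) \<longleftrightarrow> cyclically (\<lambda>x y. R (f x) (f y)) c"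
  unfolding cyclically_def by (cases "c = []") (auto simp: successively_map last_map hd_map)

text \<open>A nonconstant function on a cycle has both an ascent and a descent.\<close>

lemma cycle_cost:
  fixes h :: "'t \<Rightarrow> nat" and e :: real
  assumes c: "cyclically (\<lambda>x y. y = f x) c" and e: "0 \<le> e" "e \<le> 1"
    and const: "(\<And>x. x \<in> set c \<Longrightarrow> h x = h (hd c)) \<Longrightarrow> 1 \<le> real (card (set c)) * e"
  shows "1 \<le> (\<Sum>x\<in>set c. if h x < h (f x) then 1 - e else e)"
proof (cases "\<exists>x\<in>set c. h x < h (f x)")
  case True
  then obtain x where x: "x \<in> set c" "h x < h (f x)" by blast
  have ne: "h ` set c \<noteq> {}" using x by auto
  \<comment> \<open>The step from a maximum of \<open>h\<close> is no ascent and costs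
    \<open>e\<close>; together with the ascent at \<open>x\<close> this makes 1.\<close>
  obtain y where y: "y \<in> set c" "h y = Max (h ` set c)"
    using Max_in[of "h ` set c"] ne by (metis finite_imageI finite_set imageE)
  have "f y \<in> set c" using cyclically_next[OF c y(1)] by blast
  then have ny: "\<not> h y < h (f y)" unfolding y(2) by (simp add: not_less)
  then have "x \<noteq> y" using x by blast
  have "1 = (\<Sum>x\<in>{x, y}. if h x < h (f x) then 1 - e else e)"
    using \<open>x \<noteq> y\<close> x ny by simp
  also have "\<dots> \<le> (\<Sum>x\<in>set c. if h x < h (f x) then 1 - e else e)"
    using x y e by (intro sum_mono2) auto
  finally show ?thesis .
next
  case False
  have ne: "c \<noteq> []" using c by (simp add: cyclically_def)
  have "successively (\<lambda>x y. y = f x) c" using c by (simp add: cyclically_def)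
  \<comment> \<open>Without ascents \<open>h\<close> never increases along the list, and the closing
    step then forces it to be constant.\<close>
  then have "successively (\<lambda>x y. h y \<le> h x) c"
    using False unfolding successively_iff_nth by (metis not_less nth_mem Suc_lessD)
  then have s: "sorted_wrt (\<lambda>x y. h y \<le> h x) c"
    by (subst (asm) successively_conv_sorted_wrt) (auto simp: transp_def)
  have "hd c = f (last c)" using c by (simp add: cyclically_def)
  then have hl: "h (hd c) \<le> h (last c)" using False ne by (metis last_in_set not_less)
  have "h x = h (hd c)" if "x \<in> set c" for x
  proof -
    obtain i where i: "i < length c" "x = c ! i" using \<open>x \<in> set c\<close> by (auto simp: in_set_conv_nth)
    have mono: "h (c ! k) \<le> h (c ! j)" if "j \<le> k" "k < length c" for j k
      using s that by (cases "j = k") (auto simp: sorted_wrt_iff_nth_less)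
    have "h x \<le> h (hd c)" using mono[of 0 i] i ne by (simp add: hd_conv_nth)
    moreover have "h (last c) \<le> h x" using mono[of i "length c - 1"] i ne by (simp add: last_conv_nth)
    ultimately show ?thesis using hl by simp
  qed
  then have "1 \<le> real (card (set c)) * e" by (rule const)
  then show ?thesis using False by (simp cong: sum.cong)
qed

lemma sum_list_sum_concat:
  "distinct (concat E) \<Longrightarrow> (\<Sum>d\<leftarrow>E. \<Sum>p\<in>set d. f p) = (\<Sum>p\<in>set (concat E). f p)"
proof (induction E)
  case (Cons d E)
  then have "(\<Sum>p\<in>set (concat (d # E)). f p) = (\<Sum>p\<in>set d. f p) + (\<Sum>p\<in>set (concat E). f p)"
    by (simp add: sum.union_disjoint)
  with Cons show ?case by simp
qed simp

section \<open>Counting disks by the costs of their turns\<close>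

context chord_matching
begin

lemma even_ph: "even (ph p) = even p"
  unfolding ph_def by (simp add: dvd_mod_iff)

lemma even_nx: "z < K \<Longrightarrow> even (nx z) \<longleftrightarrow> odd z"
proof (cases "Suc z < K")
  case False
  assume "z < K"
  with False have "Suc z = K" by simp
  then have "odd z" using even_K even_Suc by metis
  then show ?thesis using False by (simp add: nx_def)
qed (simp add: nx_def)

lemma ph_lt: "ph p < 2 * L"
  unfolding ph_def using pos by simp

lemma ph_nx: "z < K \<Longrightarrow> ph (nx z) = (if ph z = 2 * L - 1 then 0 else Suc (ph z))"
proof -
  assume z: "z < K"
  have "ph (nx z) = Suc z mod (2 * L)"
  proof (cases "Suc z < K")
    case False
    then have "Suc z = 2 * L * n" using z by (simp add: K_def)
    then show ?thesis using False by (simp add: nx_def ph_def)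
  qed (simp add: nx_def ph_def)
  then show ?thesis using pos unfolding ph_def by (auto simp: mod_Suc)
qed

lemma cost_eq:
  assumes "z < K" "even p = even (nx z)"
  shows "(if ph p < ph (nx z) then 1 - \<epsilon> else \<epsilon>) = cost p z"
proof -
  have "ph p \<noteq> ph z" using assms even_nx even_ph by metis
  then have "ph p < ph (nx z) \<longleftrightarrow> ph p < ph z \<and> ph z \<noteq> 2 * L - 1"
    unfolding ph_nx[OF assms(1)] using ph_lt[of z] by auto
  then show ?thesis by (simp add: cost_def)
qed

text \<open>A disk of the glued surface, with all its letters on the boundary curve.\<close>

definition good_cycle :: "nat list \<Rightarrow> bool" where
  "good_cycle d \<longleftrightarrow> cyclically (\<lambda>p q. turn (Wt p) (Wt q)) d \<and> distinct d \<and> set d \<subseteq> {..<K} \<and>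
    mprod G (map (\<lambda>p. c (ph p)) d) = \<one> \<and> homog even d"

text \<open>A turn stays in one factor, while \<open>nx\<close> changes the parity; so an arc joins
  positions of opposite parity.\<close>

lemma good_cycle_other:
  assumes "good_cycle d" "p \<in> set d"
  shows "arc (Wt p) (Wt (other p)) \<and> other p < K \<and> (even p \<longleftrightarrow> odd (other p))"
proof -
  obtain q where q: "q \<in> set d" "turn (Wt p) (Wt q)"
    using assms cyclically_next[of _ d p] unfolding good_cycle_def by blast
  obtain z where z: "z < K" "arc (Wt p) (Wt z)" "q = nx z" using turn_arc_Wt[OF q(2)] by blast
  have "even p = even q"
    using assms q(1) homog_hd[of even d] unfolding good_cycle_def by metis
  then show ?thesis using z other_eq[OF z(2)] even_nx[of z] by auto
qed

lemma good_cycle_cost: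
  assumes d: "good_cycle d"
  shows "1 \<le> (\<Sum>p\<in>set d. cost p (other p))"
proof -
  have nx: "q = nx (other p)" if "turn (Wt p) (Wt q)" for p q
    using turn_arc_Wt[OF that] other_eq by blast
  have cyc: "cyclically (\<lambda>p q. q = nx (other p)) d"
    using d nx unfolding good_cycle_def by (blast intro: cyclically_mono)
  have "1 \<le> (\<Sum>p\<in>set d. if ph p < ph (nx (other p)) then 1 - \<epsilon> else \<epsilon>)"
  proof (rule cycle_cost[OF cyc])
    \<comment> \<open>With constant phase the disk reads a power of a single letter, and
      \<open>eps(3)\<close> bounds its length from below.\<close>
    assume const: "\<And>x. x \<in> set d \<Longrightarrow> ph x = ph (hd d)"
    have "map (\<lambda>p. c (ph p)) d = map (\<lambda>_. c (ph (hd d))) d"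
      using const by (auto simp: map_eq_conv)
    then have "mprod G (replicate (length d) (c (ph (hd d)))) = \<one>"
      using d unfolding good_cycle_def by (simp add: map_replicate_const)
    moreover have "c (ph (hd d)) \<in> carrier G" using c[OF ph_lt] H_carrier by blast
    moreover have "d \<noteq> []" using cyc by (simp add: cyclically_def)
    ultimately have "1 \<le> real (length d) * \<epsilon>"
      using eps(3)[OF ph_lt, of "length d" "hd d"] by (simp add: mprod_replicate)
    then show "1 \<le> real (card (set d)) * \<epsilon>"
      using d distinct_card[of d] by (simp add: good_cycle_def)
  qed (use eps in auto)
  also have "\<dots> = (\<Sum>p\<in>set d. cost p (other p))"
  proof (rule sum.cong[OF refl])
    fix p assume "p \<in> set d"
    then have "other p < K" "even p \<longleftrightarrow> odd (other p)" using good_cycle_other[OF d] by auto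
    then show "(if ph p < ph (nx (other p)) then 1 - \<epsilon> else \<epsilon>) = cost p (other p)"
      by (intro cost_eq) (simp_all add: even_nx)
  qed
  finally show ?thesis .
qed

text \<open>In each of the \<open>n\<close> periods, \<open>L - 1\<close> odd positions contribute 1
  and the last one \<open>2 * \<epsilon>\<close>.\<close>

lemma sum_top: "(\<Sum>z\<in>{z. z < K \<and> odd z}. if ph z = 2 * L - 1 then 2 * \<epsilon> else 1)
    = real n * (real L - 1 + 2 * \<epsilon>)"
proof -
  define t where "t j = (if j mod L = L - 1 then 2 * \<epsilon> else (1::real))" for j
  have "{z. z < K \<and> odd z} = (\<lambda>j. 2 * j + 1) ` {..<L * n}"
    unfolding K_def by (auto elim!: oddE)
  then have "(\<Sum>z\<in>{z. z < K \<and> odd z}. if ph z = 2 * L - 1 then 2 * \<epsilon> else 1) =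
      (\<Sum>j<L * n. if ph (2 * j + 1) = 2 * L - 1 then 2 * \<epsilon> else 1)"
    by (simp add: sum.reindex inj_on_def)
  also have "\<dots> = (\<Sum>j<L * n. t j)"
  proof (rule sum.cong[OF refl])
    fix j
    have "ph (2 * j + 1) = 2 * (j mod L) + 1"
    proof -
      have "Suc (2 * (j mod L)) \<noteq> 2 * L" by (metis dvd_triv_left even_Suc)
      then show ?thesis
        using mod_Suc[of "2 * j" "2 * L"] by (simp add: ph_def mod_mult_mult1)
    qed
    then show "(if ph (2 * j + 1) = 2 * L - 1 then 2 * \<epsilon> else 1) = t j"
      unfolding t_def using pos by auto
  qed
  also have "(\<Sum>j<L * k. t j) = real k * (\<Sum>j<L. t j)" for k
  proof (induction k)
    case (Suc k)
    have "(\<Sum>j<L * Suc k. t j) = (\<Sum>j<L * k. t j) + (\<Sum>j=L * k..<L * k + L. t j)"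
      by (simp add: lessThan_atLeast0 sum.atLeastLessThan_concat add.commute)
    also have "(\<Sum>j=L * k..<L * k + L. t j) = (\<Sum>j<L. t (j + L * k))"
      using sum.shift_bounds_nat_ivl[of t 0 "L * k" L] by (simp add: lessThan_atLeast0 add.commute)
    also have "\<dots> = (\<Sum>j<L. t j)" by (simp add: t_def)
    finally show ?case using Suc by (simp add: algebra_simps)
  qed simp
  also have "(\<Sum>j<L. t j) = real L - 1 + 2 * \<epsilon>"
  proof -
    obtain l where l: "L = Suc l" using pos by (cases L) auto
    have "(\<Sum>j<l. t j) = (\<Sum>j<l. 1)" by (rule sum.cong) (auto simp: t_def l)
    moreover have "t l = 2 * \<epsilon>" by (simp add: t_def l)
    ultimately show ?thesis by (simp add: l)
  qed
  finally show ?thesis .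
qed

text \<open>Every disk costs at least 1. The turns on the two banks of an arc are both charged to
  its odd end, and the total is bounded by \<open>sum_top\<close>.\<close>

lemma good_cycles_bound:
  assumes E: "\<forall>d\<in>set E. good_cycle d" "distinct (concat E)"
  shows "real (length E) \<le> real n * (real L - 1 + 2 * \<epsilon>)"
proof -
  define S where "S = set (concat E)"
  have o: "arc (Wt p) (Wt (other p))" "other p < K" "even p \<longleftrightarrow> odd (other p)" "p < K"
    if p: "p \<in> S" for p
  proof -
    obtain d where d: "d \<in> set E" "p \<in> set d" using p unfolding S_def by auto
    then show "arc (Wt p) (Wt (other p))" "other p < K" "even p \<longleftrightarrow> odd (other p)"
      using good_cycle_other E by blast+
    show "p < K" using d E unfolding good_cycle_def by blast
  qed
  have oo: "other (other p) = p" if "p \<in> S" for p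
    using o(1)[OF that] arc_sym other_eq by blast
  define Se where "Se = {p\<in>S. even p}"
  define So where "So = {p\<in>S. odd p}"
  have fin: "finite S" "finite Se" "finite So" by (simp_all add: S_def Se_def So_def)
  have cost0: "0 \<le> cost p z" for p z using eps by (simp add: cost_def)
  \<comment> \<open>The two banks compare the same phases in opposite directions. Exactly one is an
    ascent, except that neither is when the odd end closes a period.\<close>
  have odd_cost: "cost z (other z) + cost (other z) z = (if ph z = 2 * L - 1 then 2 * \<epsilon> else 1)"
    if "odd z" "even (other z)" for z
  proof -
    have "odd (ph z)" "even (ph (other z))" using that even_ph by auto
    then have "ph z \<noteq> ph (other z)" "ph (other z) \<noteq> 2 * L - 1" using pos by auto
    then show ?thesis using ph_lt[of "other z"] unfolding cost_def by auto
  qed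
  have "real (length E) = (\<Sum>d\<leftarrow>E. 1)" by (simp add: sum_list_triv)
  also have "\<dots> \<le> (\<Sum>d\<leftarrow>E. \<Sum>p\<in>set d. cost p (other p))"
    using E good_cycle_cost by (intro sum_list_mono) auto
  also have "\<dots> = (\<Sum>p\<in>S. cost p (other p))"
    unfolding S_def by (rule sum_list_sum_concat[OF E(2)])
  also have "\<dots> = (\<Sum>p\<in>So \<union> Se. cost p (other p))"
    by (rule sum.cong) (auto simp: So_def Se_def)
  also have "\<dots> = (\<Sum>p\<in>So. cost p (other p)) + (\<Sum>p\<in>Se. cost p (other p))"
    using fin by (intro sum.union_disjoint) (auto simp: So_def Se_def)
  also have "(\<Sum>p\<in>Se. cost p (other p)) = (\<Sum>z\<in>other ` Se. cost (other z) z)"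
  proof -
    have "inj_on other Se" by (rule inj_on_inverseI[of _ other]) (auto simp: Se_def oo)
    then have "(\<Sum>z\<in>other ` Se. cost (other z) z) = (\<Sum>p\<in>Se. cost (other (other p)) (other p))"
      by (simp add: sum.reindex)
    also have "\<dots> = (\<Sum>p\<in>Se. cost p (other p))"
      by (rule sum.cong) (auto simp: Se_def oo)
    finally show ?thesis by simp
  qed
  \<comment> \<open>An arc may border a disk on one bank only; as costs are nonnegative, the other
    bank may be added.\<close>
  also have "(\<Sum>p\<in>So. cost p (other p)) \<le> (\<Sum>z\<in>So \<union> other ` Se. cost z (other z))"
    using fin cost0 by (intro sum_mono2) auto
  also have "(\<Sum>z\<in>other ` Se. cost (other z) z) \<le> (\<Sum>z\<in>So \<union> other ` Se. cost (other z) z)"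
    using fin cost0 by (intro sum_mono2) auto
  also have "(\<Sum>z\<in>So \<union> other ` Se. cost z (other z)) + (\<Sum>z\<in>So \<union> other ` Se. cost (other z) z) =
      (\<Sum>z\<in>So \<union> other ` Se. if ph z = 2 * L - 1 then 2 * \<epsilon> else 1)"
    unfolding sum.distrib[symmetric]
  proof (rule sum.cong[OF refl])
    fix z assume z: "z \<in> So \<union> other ` Se"
    have "odd z \<and> even (other z)"
    proof (cases "z \<in> So")
      case True
      then show ?thesis using o(3) by (auto simp: So_def)
    next
      case False
      then obtain p where "z = other p" "p \<in> S" "even p" using z by (auto simp: Se_def)
      then show ?thesis using o(3) oo by auto
    qed
    then show "cost z (other z) + cost (other z) z = (if ph z = 2 * L - 1 then 2 * \<epsilon> else 1)"
      using odd_cost by blast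
  qed
  also have "\<dots> \<le> (\<Sum>z\<in>{z. z < K \<and> odd z}. if ph z = 2 * L - 1 then 2 * \<epsilon> else 1)"
    using eps o by (intro sum_mono2) (auto simp: So_def Se_def)
  also have "\<dots> = real n * (real L - 1 + 2 * \<epsilon>)" by (rule sum_top)
  finally show ?thesis by simp
qed

text \<open>Each letter of a gluing word costs at most one cell, so at least
  \<open>1 + L * n - m\<close> disks survive; \<open>good_cycles_bound\<close> limits them from
  above.\<close>

lemma pairs_bound:
  assumes Rs: "mset (concat Rs) = mset W" "length Rs = 1 + L * n + (\<Sum>i<m. len i - 1)"
    and cells: "\<forall>c\<in>set Rs. cell tp val adj c"
  shows "real n * (1 - 2 * \<epsilon>) + 1 \<le> real m"
proof -
  have sW: "set (concat Rs) = set W" using Rs(1) by (rule mset_eq_setD)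
  have "distinct (concat Rs)" using distinct_W mset_eq_imp_distinct_iff[OF Rs(1)] by simp
  moreover have "\<forall>c\<in>set Rs. cell tp val turn c"
    using cells by (blast intro: cell_mono path.base)
  moreover have "\<forall>x\<in>set (concat Rs). val x \<in> carrier G"
    unfolding sW using val_H H_carrier by blast
  ultimately obtain Ds where Ds: "length Rs \<le> length Ds + length pairs" "distinct (concat Ds)"
    "set (concat Ds) \<subseteq> set (concat Rs) - fst ` set pairs - snd ` set pairs"
    "\<forall>c\<in>set Ds. cell tp val turn c"
    using glue_cells[of Rs pairs tp val turn wt] pairs_props(1) gluable_pairs
      cells_weight[OF Rs(1) cells] by blast
  have DW: "set (concat Ds) \<subseteq> Wt ` {..<K}"
    using Ds(3) pairs_props(3) unfolding sW set_W by blast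
  \<comment> \<open>The value on band letters is a dummy, since all of them have been glued
    away.\<close>
  define pos where "pos x = (case x of Wt p \<Rightarrow> p | Bt i s r \<Rightarrow> r)" for x
  define E where "E = map (map pos) Ds"
  have DE: "d = map Wt (map pos d)" if "d \<in> set Ds" for d
  proof -
    have "Wt (pos x) = x" if "x \<in> set d" for x
      using that \<open>d \<in> set Ds\<close> DW by (force simp: pos_def)
    then show ?thesis by (simp add: map_idI)
  qed
  have "good_cycle (map pos d)" if d: "d \<in> set Ds" for d
  proof -
    have cd: "cell tp val turn (map Wt (map pos d))" using Ds(4) d DE[OF d] by metis
    have "distinct d" using Ds(2) d by (simp add: distinct_concat_iff)
    then have "distinct (map Wt (map pos d))" using DE[OF d] by metis
    then have "distinct (map pos d)" unfolding distinct_map by blast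
    moreover have "set (map pos d) \<subseteq> {..<K}" using DW d by (force simp: pos_def)
    moreover have "homog even (map pos d)"
      using cd unfolding cell_def homog_def by (auto simp del: map_map)
    moreover have "cyclically (\<lambda>p q. turn (Wt p) (Wt q)) (map pos d)"
      using cd unfolding cell_def cyclically_map[symmetric, of turn Wt] by blast
    moreover have "mprod G (map (\<lambda>p. c (ph p)) (map pos d)) = \<one>"
    proof -
      have "map val (map Wt (map pos d)) = map (\<lambda>p. c (ph p)) (map pos d)" by (simp add: ph_def)
      then show ?thesis using cd unfolding cell_def by metis
    qed
    ultimately show ?thesis unfolding good_cycle_def by blast
  qed
  then have "\<forall>d\<in>set E. good_cycle d" by (auto simp: E_def)
  moreover have "distinct (concat E)"
  proof -
    have "concat E = map pos (concat Ds)" by (simp add: E_def map_concat)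
    moreover have "inj_on pos (set (concat Ds))"
      by (rule inj_on_subset[OF _ DW]) (auto simp: inj_on_def pos_def)
    ultimately show ?thesis using Ds(2) by (simp only: distinct_map)
  qed
  ultimately have "real (length E) \<le> real n * (real L - 1 + 2 * \<epsilon>)" by (rule good_cycles_bound)
  moreover have "length E = length Ds" by (simp add: E_def)
  moreover have "(\<Sum>i<m. len i) = (\<Sum>i<m. len i - 1) + m"
  proof -
    have "(\<Sum>i<m. len i) = (\<Sum>i<m. (len i - 1) + 1)"
      using len_pos by (intro sum.cong) (auto simp: Suc_leI)
    then show ?thesis by (simp only: sum.distrib) simp
  qed
  ultimately have "real (1 + L * n) \<le> real n * (real L - 1 + 2 * \<epsilon>) + real m"
    using Ds(1) Rs(2) pairs_props(2) by linarith
  then show ?thesis by (simp add: algebra_simps)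
qed

end

lemma (in surface_data) gluing_bound: "real n * (1 - 2 * \<epsilon>) + 1 \<le> real m"
proof -
  obtain Rs M where R: "mset (concat Rs) = mset W" "length Rs = 1 + L * n + (\<Sum>i<m. len i - 1)"
    "\<forall>c\<in>set Rs. cell tp val (\<lambda>x y. junction x y \<or> (\<exists>u. M x u \<and> y = sig u)) c"
    "symp M" "right_unique M" "\<forall>x u. M x u \<longrightarrow> crossing x"
    using ex_cells by blast
  interpret chord_matching G H c L n m xw zs \<epsilon> M
    using R(4,5,6) by unfold_locales (auto dest: sympD right_uniqueD)
  have "adj = (\<lambda>x y. junction x y \<or> (\<exists>u. M x u \<and> y = sig u))" by (auto simp: adj_def fun_eq_iff)
  then show ?thesis using pairs_bound R(1,2,3) by simp
qed

section \<open>From commutators to gluing words\<close>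

context free_factors
begin

text \<open>The alternating form of \<open>x\<close> receives a trivial letter at an end that is not
  in \<open>H True\<close>. Padding occurs at the ends only, so interior letters stay
  nontrivial.\<close>

lemma ex_padded:
  assumes "x \<in> carrier G"
  shows "\<exists>Y. odd (length Y) \<and> (\<forall>r<length Y. Y ! r \<in> H (even r)) \<and>
    (\<forall>r. 0 < r \<longrightarrow> Suc r < length Y \<longrightarrow> Y ! r \<noteq> \<one>) \<and> mprod G Y = x"
proof -
  let ?alt = "successively (\<lambda>x y. fst x \<noteq> fst y) :: (bool \<times> 'g) list \<Rightarrow> bool"
  obtain xs where xs: "?alt xs" "\<forall>p\<in>set xs. snd p \<in> H (fst p) \<and> snd p \<noteq> \<one>" "mprod G (map snd xs) = x"
    using ex_alternating[OF assms] by fastforce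
  define pre where "pre = (if xs = [] \<or> \<not> fst (hd xs) then [(True, \<one>)] else [])"
  \<comment> \<open>If \<open>xs\<close> is empty, \<open>pre\<close> is already the whole word;
    therefore the last letter of \<open>pre @ xs\<close> decides.\<close>
  define post where "post = (if fst (last (pre @ xs)) then [] else [(True, \<one>)])"
  define ws where "ws = pre @ xs @ post"
  have ws: "?alt ws" "ws \<noteq> []" "fst (hd ws)" "fst (last ws)"
    using xs(1) unfolding ws_def pre_def post_def
    by (auto simp: successively_append_iff successively_Cons hd_append)
  have par: "r < length ws \<Longrightarrow> fst (ws ! r) = even r" for r
  proof (induction r)
    case 0
    then show ?case using ws by (simp add: hd_conv_nth)
  next
    case (Suc r)
    then show ?case using ws(1) unfolding successively_iff_nth by auto
  qed
  have in_H: "snd p \<in> H (fst p)" if "p \<in> set ws" for p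
    using that xs(2) subgroup.one_closed[OF sub]
    by (auto simp: ws_def pre_def post_def split: if_splits)
  have len: "length pre \<le> 1" "length post \<le> 1" by (simp_all add: pre_def post_def)
  have "odd (length ws)"
    using par[of "length ws - 1"] ws by (cases "length ws") (auto simp: last_conv_nth)
  moreover have "map snd ws ! r \<in> H (even r)" if "r < length ws" for r
    using in_H[of "ws ! r"] par[OF that] that by simp
  moreover have "map snd ws ! r \<noteq> \<one>" if "0 < r" "Suc r < length ws" for r
  proof -
    have "r - length pre < length xs" "length pre \<le> r"
      using that len unfolding ws_def by auto
    then have "ws ! r \<in> set xs" unfolding ws_def by (simp add: nth_append)
    then show ?thesis using xs(2) that by simp
  qed
  moreover have "mprod G (map snd ws) = x"
  proof -
    have "set (map snd xs) \<subseteq> carrier G" using xs(2) H_carrier by auto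
    then have "mprod G (map snd (xs @ post)) = x"
      using xs(3) assms by (simp add: mprod_append post_def)
    then show ?thesis using assms by (simp add: ws_def pre_def)
  qed
  ultimately show ?thesis by (intro exI[of _ "map snd ws"]) simp
qed

text \<open>The gluing words are the entries of the commutators together with a trivial one, which makes
  their number positive and accounts for the \<open>1\<close> in \<open>gluing_bound\<close>.\<close>

lemma commutator_bound:
  fixes k L n :: nat and \<epsilon> :: real
  assumes pos: "L > 0" "n > 0"
    and c: "\<And>p. p < 2 * L \<Longrightarrow> c p \<in> H (even p)"
    and eps: "0 \<le> \<epsilon>" "\<epsilon> \<le> 1 / 2"
      "\<And>p r. p < 2 * L \<Longrightarrow> 0 < r \<Longrightarrow> c p [^] (r::nat) = \<one> \<Longrightarrow> 1 \<le> real r * \<epsilon>"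
    and ab: "\<And>i. i < k \<Longrightarrow> a i \<in> carrier G \<and> b i \<in> carrier G"
    and eq: "mprod G (map (\<lambda>p. c (p mod (2 * L))) [0..<2 * L * n]) =
      mprod G (map (\<lambda>i. commutator G (a i) (b i)) [0..<k])"
  shows "real n * (1 / 2 - \<epsilon>) \<le> real k"
proof -
  \<comment> \<open>Even indices carry the entries \<open>a i\<close> and odd ones the
    \<open>b i\<close>; index \<open>2 * k\<close> gives the additional trivial element.\<close>
  define y where "y j = (if j < 2 * k then if even j then a (j div 2) else b (j div 2) else \<one>)" for j
  have y: "y j \<in> carrier G" for j
    using ab[of "j div 2"] by (auto simp: y_def less_mult_imp_div_less mult.commute)
  define f where "f = (\<lambda>(i, s). if s then y i else inv (y i))"
  \<comment> \<open>The inverse of a commutator of \<open>a\<close> and \<open>b\<close> is b a b^-1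
    a^-1, and inverting the product reverses the order of the commutators.\<close>
  define Z where "Z l = concat (map (\<lambda>i. [(2 * i + 1, True), (2 * i, True), (2 * i + 1, False), (2 * i, False)])
    (rev [0..<l]))" for l :: nat
  have Z_Suc: "Z (Suc l) = [(2 * l + 1, True), (2 * l, True), (2 * l + 1, False), (2 * l, False)] @ Z l" for l
    by (simp add: Z_def)
  have Z_set: "set (Z l) = {..<2 * l} \<times> UNIV" for l
  proof (induction l)
    case (Suc l)
    have "{..<2 * Suc l} = {2 * l + 1, 2 * l} \<union> {..<2 * l}" by auto
    then show ?case unfolding Z_Suc set_append Suc by (auto simp: UNIV_bool)
  qed (simp add: Z_def)
  have Z_distinct: "distinct (Z l)" for l
    by (induction l) (simp_all add: Z_Suc Z_set, simp add: Z_def)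
  have f: "f z \<in> carrier G" for z using y by (simp add: f_def split: prod.split)
  have comm: "commutator G (a i) (b i) \<in> carrier G" if "i < k" for i
    using ab[OF that] by (simp add: commutator_def)
  have Z_prod: "l \<le> k \<Longrightarrow> mprod G (map f (Z l)) = inv (mprod G (map (\<lambda>i. commutator G (a i) (b i)) [0..<l]))" for l
  proof (induction l)
    case (Suc l)
    let ?C = "\<lambda>l. mprod G (map (\<lambda>i. commutator G (a i) (b i)) [0..<l])"
    have cl: "set (map (\<lambda>i. commutator G (a i) (b i)) [0..<l]) \<subseteq> carrier G" "?C l \<in> carrier G"
      using comm Suc.prems by (auto intro!: mprod_closed)
    have ab': "a l \<in> carrier G" "b l \<in> carrier G" using ab Suc.prems by auto
    have "?C (Suc l) = ?C l \<otimes> commutator G (a l) (b l)"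
      using cl comm Suc.prems by (simp add: mprod_append)
    then have "inv (?C (Suc l)) = inv (commutator G (a l) (b l)) \<otimes> inv (?C l)"
      using cl comm Suc.prems by (simp add: inv_mult_group)
    also have "inv (commutator G (a l) (b l)) = b l \<otimes> (a l \<otimes> (inv (b l) \<otimes> inv (a l)))"
      using ab' unfolding commutator_def by (simp add: inv_mult_group m_assoc)
    also have "\<dots> \<otimes> inv (?C l) = mprod G (map f (Z (Suc l)))"
      using ab' cl Suc unfolding Z_Suc by (simp add: f_def y_def m_assoc)
    finally show ?case by simp
  qed (simp add: Z_def)
  define zs where "zs = Z k @ [(2 * k, True), (2 * k, False)]"
  define xw where "xw i = (SOME Y. odd (length Y) \<and> (\<forall>r<length Y. Y ! r \<in> H (even r)) \<and>
    (\<forall>r. 0 < r \<longrightarrow> Suc r < length Y \<longrightarrow> Y ! r \<noteq> \<one>) \<and> mprod G Y = y i)" for i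
  have xw: "odd (length (xw i)) \<and> (\<forall>r<length (xw i). xw i ! r \<in> H (even r)) \<and>
    (\<forall>r. 0 < r \<longrightarrow> Suc r < length (xw i) \<longrightarrow> xw i ! r \<noteq> \<one>) \<and> mprod G (xw i) = y i" for i
    unfolding xw_def by (rule someI_ex[OF ex_padded[OF y]])
  let ?w = "mprod G (map (\<lambda>p. c (p mod (2 * L))) [0..<2 * L * n])"
  have w: "?w \<in> carrier G"
  proof -
    have "c (p mod (2 * L)) \<in> carrier G" for p
      using H_carrier[OF c[of "p mod (2 * L)"]] pos by simp
    then show ?thesis by (intro mprod_closed) auto
  qed
  have "mprod G (map f zs) = inv ?w"
  proof -
    have "set (map f (Z k)) \<subseteq> carrier G" using f by auto
    moreover have "f (2 * k, True) = \<one>" "f (2 * k, False) = \<one>" by (simp_all add: f_def y_def)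
    moreover have "inv (mprod G (map (\<lambda>i. commutator G (a i) (b i)) [0..<k])) \<in> carrier G"
      using comm by (intro inv_closed mprod_closed) auto
    ultimately show ?thesis unfolding zs_def eq by (simp add: mprod_append Z_prod)
  qed
  moreover have "map f zs = map (\<lambda>(i, s). if s then mprod G (xw i) else inv (mprod G (xw i))) zs"
  proof -
    have "mprod G (xw i) = y i" for i using xw by blast
    then show ?thesis by (simp add: f_def split: prod.split)
  qed
  ultimately have one: "?w \<otimes> mprod G (map (\<lambda>(i, s). if s then mprod G (xw i) else inv (mprod G (xw i))) zs) = \<one>"
    using w by simp
  have "surface_data G H c L n (2 * k + 1) xw zs \<epsilon>"
  proof (unfold_locales)
    show "distinct zs" by (simp add: zs_def Z_distinct Z_set)
    have "{..<2 * k + 1} = insert (2 * k) {..<2 * k}" by auto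
    then show "set zs = {..<2 * k + 1} \<times> UNIV" by (auto simp: zs_def Z_set UNIV_bool)
  qed (use pos c eps xw one in auto)
  then interpret surface_data G H c L n "2 * k + 1" xw zs \<epsilon> .
  have "real n * (1 - 2 * \<epsilon>) + 1 \<le> real (2 * k + 1)" by (rule gluing_bound)
  then show ?thesis by (simp add: field_simps)
qed

end

section \<open>Stable commutator length\<close>

text \<open>Fekete's lemma, with the infimum of the quotients as limit: divide \<open>n\<close> by a
  \<open>k\<close> whose quotient is nearly optimal, and bound the contribution of the remainder by
  a constant \<open>C\<close>.\<close>

lemma subadditive_convergent:
  fixes f :: "nat \<Rightarrow> real"
  assumes nonneg: "\<And>n. 0 \<le> f n" and subadd: "\<And>m n. f (m + n) \<le> f m + f n"
  shows "convergent (\<lambda>n. f n / real n)"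
proof -
  define l where "l = (INF n\<in>{1..}. f n / real n)"
  have bdd: "bdd_below ((\<lambda>n. f n / real n) ` {1..})"
    by (rule bdd_belowI[of _ 0]) (auto simp: nonneg)
  have "(\<lambda>n. f n / real n) \<longlonglongrightarrow> l"
  proof (rule LIMSEQ_I)
    fix r :: real assume r: "0 < r"
    have "l < l + r / 2" using r by simp
    then obtain k where k: "1 \<le> k" "f k / real k < l + r / 2"
      unfolding l_def using bdd by (subst (asm) cINF_less_iff) auto
    have mult: "f (q * k + s) \<le> real q * f k + f s" for q s
    proof (induction q)
      case (Suc q)
      have "f (Suc q * k + s) = f (k + (q * k + s))" by (simp add: add.assoc)
      also have "\<dots> \<le> f k + f (q * k + s)" by (rule subadd)
      finally show ?case using Suc by (simp add: algebra_simps)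
    qed simp
    define C where "C = Max (f ` {..<k})"
    have C: "f s \<le> C" if "s < k" for s using that by (simp add: C_def)
    have C0: "0 \<le> C" using C[of 0] nonneg[of 0] k by linarith
    obtain N where N: "real N > 2 * C / r" using reals_Archimedean2 by blast
    show "\<exists>N. \<forall>n\<ge>N. norm (f n / real n - l) < r"
    proof (intro exI[of _ "Suc N"] allI impI)
      fix n assume n: "Suc N \<le> n"
      have "l \<le> f n / real n" unfolding l_def using n by (intro cINF_lower[OF bdd]) auto
      moreover have "f n \<le> real (n div k) * f k + C"
        using mult[of "n div k" "n mod k"] C[of "n mod k"] k by simp
      moreover have "real (n div k) * f k \<le> real n * (f k / real k)"
      proof -
        have "real (n div k * k) \<le> real n" unfolding of_nat_le_iff by (rule div_times_less_eq_dividend)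
        then have "real (n div k) \<le> real n / real k" using k by (simp add: pos_le_divide_eq)
        then have "real (n div k) * f k \<le> real n / real k * f k" using nonneg by (rule mult_right_mono)
        then show ?thesis by simp
      qed
      ultimately have fn: "f n \<le> real n * (f k / real k) + C" by linarith
      have "f n / real n \<le> (real n * (f k / real k) + C) / real n"
        using fn n by (intro divide_right_mono) auto
      also have "\<dots> = f k / real k + C / real n" using n by (simp add: add_divide_distrib)
      also have "C / real n < r / 2"
      proof -
        have "2 * C / r < real n" using N n by linarith
        then have "2 * C < real n * r" using r by (simp add: pos_divide_less_eq)
        then show ?thesis using n by (simp add: field_simps)
      qed
      finally have "f n / real n < l + r" using k(2) by linarith
      then show "norm (f n / real n - l) < r" using \<open>l \<le> f n / real n\<close> by simp
    qed
  qed
  then show ?thesis by (rule convergentI)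
qed

context group
begin

definition comm_prod :: "nat \<Rightarrow> 'a \<Rightarrow> bool" where
  "comm_prod n h \<longleftrightarrow> (\<exists>a b. (\<forall>i<n. a i \<in> carrier G \<and> b i \<in> carrier G) \<and>
       h = mprod G (map (\<lambda>i. commutator G (a i) (b i)) [0..<n]))"

lemma comm_length_eq: "comm_length G h = (LEAST n. comm_prod n h)"
  by (simp add: comm_length_def comm_prod_def)

lemma comm_prod_0: "comm_prod 0 h \<longleftrightarrow> h = \<one>"
  by (simp add: comm_prod_def)

lemma commutator_closed [simp]:
  "a \<in> carrier G \<Longrightarrow> b \<in> carrier G \<Longrightarrow> commutator G a b \<in> carrier G"
  by (simp add: commutator_def)

lemma comm_prod_commutator:
  "a \<in> carrier G \<Longrightarrow> b \<in> carrier G \<Longrightarrow> comm_prod 1 (commutator G a b)"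
  unfolding comm_prod_def by (intro exI[of _ "\<lambda>_. a"] exI[of _ "\<lambda>_. b"]) simp

lemma comm_prod_mult:
  assumes "comm_prod m g" "comm_prod n h"
  shows "comm_prod (m + n) (g \<otimes> h)"
proof -
  obtain a b where ab: "\<And>i. i < m \<Longrightarrow> a i \<in> carrier G \<and> b i \<in> carrier G"
      "g = mprod G (map (\<lambda>i. commutator G (a i) (b i)) [0..<m])"
    using assms(1) unfolding comm_prod_def by auto
  obtain a' b' where ab': "\<And>i. i < n \<Longrightarrow> a' i \<in> carrier G \<and> b' i \<in> carrier G"
      "h = mprod G (map (\<lambda>i. commutator G (a' i) (b' i)) [0..<n])"
    using assms(2) unfolding comm_prod_def by auto
  define a'' where "a'' i = (if i < m then a i else a' (i - m))" for i
  define b'' where "b'' i = (if i < m then b i else b' (i - m))" for i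
  have carr: "\<forall>i<m + n. a'' i \<in> carrier G \<and> b'' i \<in> carrier G"
    using ab(1) ab'(1) by (auto simp: a''_def b''_def)
  have "map (\<lambda>i. commutator G (a'' i) (b'' i)) [0..<m + n] =
      map (\<lambda>i. commutator G (a i) (b i)) [0..<m] @ map (\<lambda>i. commutator G (a' i) (b' i)) [0..<n]"
    by (rule nth_equalityI) (auto simp: nth_append a''_def b''_def)
  then have "mprod G (map (\<lambda>i. commutator G (a'' i) (b'' i)) [0..<m + n]) = g \<otimes> h"
    unfolding ab(2) ab'(2) using ab(1) ab'(1) by (auto simp: image_subset_iff intro!: mprod_append)
  then show ?thesis using carr unfolding comm_prod_def by metis
qed

text \<open>The inverse of a commutator is a commutator, so generating the subgroup needs only
  products. This makes the \<open>LEAST\<close> in \<open>comm_length\<close> attained.\<close>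

lemma derived_comm_prod: "h \<in> derived G (carrier G) \<Longrightarrow> \<exists>n. comm_prod n h"
  unfolding derived_def
proof (induction rule: generate.induct)
  case one
  show ?case using comm_prod_0 by blast
next
  case (incl h)
  then obtain a b where "a \<in> carrier G" "b \<in> carrier G" "h = commutator G a b"
    by (auto simp: commutator_def)
  then show ?case using comm_prod_commutator by blast
next
  case (inv h)
  then obtain a b where ab: "a \<in> carrier G" "b \<in> carrier G" "h = a \<otimes> b \<otimes> inv a \<otimes> inv b"
    by auto
  then have "inv h = commutator G b a"
    by (simp add: commutator_def inv_mult_group m_assoc)
  then show ?case using comm_prod_commutator ab by metis
next
  case (eng h1 h2)
  then show ?case using comm_prod_mult by blast
qed

lemma comm_prod_pow: "comm_prod k g \<Longrightarrow> \<exists>m. comm_prod m (g [^] (n::nat))"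
proof (induction n)
  case 0
  show ?case using comm_prod_0 by auto
next
  case (Suc n)
  then show ?case using comm_prod_mult by (metis nat_pow_Suc)
qed

lemma comm_prod_comm_length: "comm_prod k h \<Longrightarrow> comm_prod (comm_length G h) h"
  unfolding comm_length_eq by (rule LeastI)

lemma comm_prod_closed: "comm_prod k h \<Longrightarrow> h \<in> carrier G"
  unfolding comm_prod_def by (auto intro!: mprod_closed)

text \<open>\<open>scl\<close> is given by \<open>lim\<close>, so the bound passes to it only after
  convergence is known; this comes from subadditivity of commutator length on powers.\<close>

lemma scl_ge:
  assumes g: "g \<in> derived G (carrier G)"
    and bound: "\<And>n k. 0 < n \<Longrightarrow> comm_prod k (g [^] n) \<Longrightarrow> real n * C \<le> real k"
  shows "C \<le> scl G g"
proof -
  obtain k where k: "comm_prod k g" using derived_comm_prod g by blast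
  have cl: "comm_prod (comm_length G (g [^] n)) (g [^] n)" for n :: nat
    using comm_prod_pow[OF k] comm_prod_comm_length by blast
  have "comm_length G (g [^] (m + n)) \<le> comm_length G (g [^] m) + comm_length G (g [^] n)" for m n :: nat
  proof -
    have "comm_prod (comm_length G (g [^] m) + comm_length G (g [^] n)) (g [^] (m + n))"
      using comm_prod_mult[OF cl cl] comm_prod_closed[OF k] by (simp add: nat_pow_mult)
    then show ?thesis unfolding comm_length_eq[of "g [^] (m + n)"] by (rule Least_le)
  qed
  then have "convergent (\<lambda>n. real (comm_length G (g [^] n)) / real n)"
    by (intro subadditive_convergent) (auto simp flip: of_nat_add)
  then have "(\<lambda>n. real (comm_length G (g [^] n)) / real n) \<longlonglongrightarrow> scl G g"
    unfolding scl_def by (simp add: convergent_LIMSEQ_iff)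
  moreover have "C \<le> real (comm_length G (g [^] n)) / real n" if "1 \<le> n" for n
    using bound[OF _ cl, of n] that by (simp add: field_simps)
  ultimately show ?thesis by (intro LIMSEQ_le_const) auto
qed

end

section \<open>Orders of the letters and powers of the word\<close>

lemma inv_min_order_props:
  assumes A: "group A" and B: "group B"
    and a': "\<forall>i<L. as i \<in> carrier A \<and> as i \<noteq> \<one>\<^bsub>A\<^esub>"
    and b': "\<forall>i<L. bs i \<in> carrier B \<and> bs i \<noteq> \<one>\<^bsub>B\<^esub>"
  shows "0 \<le> inv_min_order A B L as bs" "inv_min_order A B L as bs \<le> 1 / 2"
    "\<And>i r. i < L \<Longrightarrow> 0 < r \<Longrightarrow> as i [^]\<^bsub>A\<^esub> (r::nat) = \<one>\<^bsub>A\<^esub> \<Longrightarrow> 1 \<le> real r * inv_min_order A B L as bs"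
    "\<And>i r. i < L \<Longrightarrow> 0 < r \<Longrightarrow> bs i [^]\<^bsub>B\<^esub> (r::nat) = \<one>\<^bsub>B\<^esub> \<Longrightarrow> 1 \<le> real r * inv_min_order A B L as bs"
proof -
  note a = a'[rule_format] and b = b'[rule_format]
  define F where "F = ({group.ord A (as i) | i. i < L} \<union> {group.ord B (bs i) | i. i < L}) - {0}"
  have fin: "finite F" unfolding F_def by simp
  have I: "inv_min_order A B L as bs = (if F = {} then 0 else 1 / real (Min F))"
    unfolding inv_min_order_def F_def Let_def by simp
  \<comment> \<open>Order 1 would make the letter trivial, and 0, which encodes infinite order, is
    removed from \<open>F\<close>.\<close>
  have two: "2 \<le> x" if xF: "x \<in> F" for x
  proof -
    have "x \<noteq> 1"
    proof
      assume x: "x = 1"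
      then consider i where "i < L" "group.ord A (as i) = 1" | i where "i < L" "group.ord B (bs i) = 1"
        using xF unfolding F_def by auto
      then show False
        using a b group.ord_eq_1[OF A] group.ord_eq_1[OF B] by cases blast+
    qed
    moreover have "x \<noteq> 0" using xF by (simp add: F_def)
    ultimately show ?thesis by simp
  qed
  have M: "2 \<le> Min F" if "F \<noteq> {}" using two fin that by simp
  show "0 \<le> inv_min_order A B L as bs" by (simp add: I)
  show "inv_min_order A B L as bs \<le> 1 / 2" using M by (cases "F = {}") (simp_all add: I field_simps)
  have key: "1 \<le> real r * inv_min_order A B L as bs" if "x \<in> F" "x \<le> r" for x r
  proof -
    have "Min F \<le> r" using that fin by (meson Min_le le_trans)
    moreover have "F \<noteq> {}" using that by auto
    ultimately show ?thesis using M unfolding I by (simp add: field_simps)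
  qed
  show "1 \<le> real r * inv_min_order A B L as bs"
    if "i < L" "0 < r" "as i [^]\<^bsub>A\<^esub> (r::nat) = \<one>\<^bsub>A\<^esub>" for i r
  proof -
    \<comment> \<open>A positive exponent that kills the letter is a multiple of its order, which is
      then nonzero and belongs to \<open>F\<close>.\<close>
    have "group.ord A (as i) dvd r" using group.pow_eq_id[OF A] a that by blast
    then show ?thesis using that by (intro key[of "group.ord A (as i)"]) (auto simp: F_def dvd_imp_le)
  qed
  show "1 \<le> real r * inv_min_order A B L as bs"
    if "i < L" "0 < r" "bs i [^]\<^bsub>B\<^esub> (r::nat) = \<one>\<^bsub>B\<^esub>" for i r
  proof -
    have "group.ord B (bs i) dvd r" using group.pow_eq_id[OF B] b that by blast
    then show ?thesis using that by (intro key[of "group.ord B (bs i)"]) (auto simp: F_def dvd_imp_le)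
  qed
qed

lemma (in group) mprod_periodic:
  assumes "\<And>p. p < N \<Longrightarrow> c p \<in> carrier G"
  shows "mprod G (map (\<lambda>p. c (p mod N)) [0..<N * n]) = mprod G (map c [0..<N]) [^] n"
proof (induction n)
  case (Suc n)
  have cl: "c (p mod N) \<in> carrier G" if "p < N * k" for p k
    using that assms[of "p mod N"] by (cases "N = 0") auto
  have "[0..<N * Suc n] = [0..<N * n] @ map (\<lambda>p. N * n + p) [0..<N]"
    by (rule nth_equalityI) (auto simp: nth_append)
  then have "map (\<lambda>p. c (p mod N)) [0..<N * Suc n] = map (\<lambda>p. c (p mod N)) [0..<N * n] @ map c [0..<N]"
    by simp
  then show ?case using Suc cl[of _ n] assms by (auto simp: image_subset_iff intro!: mprod_append[THEN trans])
qed simp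

lemma (in group) mprod_pairs:
  assumes "\<And>i. i < l \<Longrightarrow> a i \<in> carrier G \<and> b i \<in> carrier G"
  shows "mprod G (map (\<lambda>i. a i \<otimes> b i) [0..<l]) =
    mprod G (map (\<lambda>p. if even p then a (p div 2) else b (p div 2)) [0..<2 * l])"
  using assms
proof (induction l)
  case (Suc l)
  let ?c = "\<lambda>p. if even p then a (p div 2) else b (p div 2)"
  have 1: "set (map (\<lambda>i. a i \<otimes> b i) [0..<l]) \<subseteq> carrier G" "a l \<in> carrier G" "b l \<in> carrier G"
    using Suc.prems by auto
  have 2: "set (map ?c [0..<2 * l]) \<subseteq> carrier G"
    using Suc.prems by (auto simp: less_mult_imp_div_less mult.commute)
  have "map ?c [0..<2 * Suc l] = map ?c [0..<2 * l] @ [a l, b l]" by simp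
  then have "mprod G (map ?c [0..<2 * Suc l]) = mprod G (map ?c [0..<2 * l]) \<otimes> (a l \<otimes> b l)"
    using 1 2 by (simp add: mprod_append del: upt_Suc)
  moreover have "mprod G (map (\<lambda>i. a i \<otimes> b i) [0..<Suc l]) = mprod G (map (\<lambda>i. a i \<otimes> b i) [0..<l]) \<otimes> (a l \<otimes> b l)"
    using 1 by (simp add: mprod_append)
  moreover have "mprod G (map (\<lambda>i. a i \<otimes> b i) [0..<l]) = mprod G (map ?c [0..<2 * l])"
    using Suc by simp
  ultimately show ?case by (simp only:)
qed simp

theorem theorem3p1:
  fixes A :: "'a monoid" and B :: "'b monoid"
    and L :: nat and as :: "nat \<Rightarrow> 'a" and bs :: "nat \<Rightarrow> 'b"
    and g :: "('a + 'b) list"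
  assumes "group A" and "group B"
    and "L \<ge> 1"
    and "\<forall>i<L. as i \<in> carrier A \<and> as i \<noteq> \<one>\<^bsub>A\<^esub>"
    and "\<forall>i<L. bs i \<in> carrier B \<and> bs i \<noteq> \<one>\<^bsub>B\<^esub>"
    and "g = mprod (free_product A B)
               (map (\<lambda>i. fp_inl A (as i) \<otimes>\<^bsub>free_product A B\<^esub> fp_inr B (bs i)) [0..<L])"
    and "g \<in> derived (free_product A B) (carrier (free_product A B))"
  shows "scl (free_product A B) g \<ge> 1 / 2 - inv_min_order A B L as bs"
proof -
  interpret free_product_groups A B using assms(1,2) by (rule free_product_groups.intro)
  interpret G: free_factors FP "\<lambda>s. if s then fp_inl A ` carrier A else fp_inr B ` carrier B"
    by (rule free_factors_FP)
  interpret inl: group_hom A FP "fp_inl A" by (rule group_hom_inl)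
  interpret inr: group_hom B FP "fp_inr B" by (rule group_hom_inr)
  note ord = inv_min_order_props[OF assms(1,2,4,5)]
  \<comment> \<open>One period of the word, with letters of \<open>A\<close> at even and letters of
    \<open>B\<close> at odd positions.\<close>
  define c where "c p = (if even p then fp_inl A (as (p div 2)) else fp_inr B (bs (p div 2)))" for p :: nat
  have as: "as (p div 2) \<in> carrier A" and bs: "bs (p div 2) \<in> carrier B" if "p < 2 * L" for p
    using that assms(4,5) by (simp_all add: less_mult_imp_div_less mult.commute)
  have g: "g = mprod FP (map c [0..<2 * L])"
    unfolding assms(6) c_def using assms(4,5) by (intro G.mprod_pairs) auto
  have pow: "g [^]\<^bsub>FP\<^esub> n = mprod FP (map (\<lambda>p. c (p mod (2 * L))) [0..<2 * L * n])" for n :: nat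
    unfolding g using as bs by (intro G.mprod_periodic[symmetric]) (auto simp: c_def)
  \<comment> \<open>The embeddings of the factors have trivial kernel, so a power that is trivial in
    the free product is trivial in the factor, where the order is measured.\<close>
  have c_ord: "1 \<le> real r * inv_min_order A B L as bs"
    if "p < 2 * L" "0 < r" "c p [^]\<^bsub>FP\<^esub> (r::nat) = \<one>\<^bsub>FP\<^esub>" for p r
  proof -
    have "p div 2 < L" using that by (simp add: less_mult_imp_div_less mult.commute)
    show ?thesis
    proof (cases "even p")
      case True
      then have "fp_inl A (as (p div 2) [^]\<^bsub>A\<^esub> r) = ([] :: ('a + 'b) list)"
        using that(3) inl.hom_nat_pow[OF as[OF that(1)], of r] by (simp add: c_def one_FP)
      then show ?thesis using ord(3)[OF \<open>p div 2 < L\<close> \<open>0 < r\<close>] by (simp add: fp_inl_def split: if_splits)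
    next
      case False
      then have "fp_inr B (bs (p div 2) [^]\<^bsub>B\<^esub> r) = ([] :: ('a + 'b) list)"
        using that(3) inr.hom_nat_pow[OF bs[OF that(1)], of r] by (simp add: c_def one_FP)
      then show ?thesis using ord(4)[OF \<open>p div 2 < L\<close> \<open>0 < r\<close>] by (simp add: fp_inr_def split: if_splits)
    qed
  qed
  show ?thesis
  proof (rule G.scl_ge[OF assms(7)])
    fix n k :: nat assume n: "0 < n" and k: "G.comm_prod k (g [^]\<^bsub>FP\<^esub> n)"
    then obtain a b where ab: "\<And>i. i < k \<Longrightarrow> a i \<in> carrier FP \<and> b i \<in> carrier FP"
        "g [^]\<^bsub>FP\<^esub> n = mprod FP (map (\<lambda>i. commutator FP (a i) (b i)) [0..<k])"
      unfolding G.comm_prod_def by auto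
    show "real n * (1 / 2 - inv_min_order A B L as bs) \<le> real k"
    proof (rule G.commutator_bound[where c=c and a=a and b=b and L=L and n=n])
      show "c p \<in> (if even p then fp_inl A ` carrier A else fp_inr B ` carrier B)" if "p < 2 * L" for p
        using as[OF that] bs[OF that] by (simp add: c_def)
    qed (use assms(3) n ord ab pow c_ord in auto)
  qed
qed

end
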